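(* There are no positive integers $x,y,z,m,n$ with $x>y\geq 1$, $m>n\ge 1$, $m$ odd, $n$ even, $1\leq z\leq x+y$ and $z\neq 2$ such that $$\varphi\left(z\frac{x^{m}+y^{m}}{x+y}\right)=z\frac{x^{n}-y^{n}}{x+y}.$$
   Context: $\varphi$ is Euler's totient function. *)

theory Defs
  imports "HOL-Number_Theory.Number_Theory"
begin

text \<open>Both quotients by \<open>x + y\<close> in the statement are exact, so \<open>div\<close> on naturals is genuine division.\<close>

lemma add_dvd_power_add_odd:
  fixes x y m :: nat
  assumes "odd m"
  shows "x + y dvd x ^ m + y ^ m"
proof -
  have "int x - (- int y) dvd int x ^ m - (- int y) ^ m"
    by (simp add: power_diff_sumr2)
  then have "int (x + y) dvd int (x ^ m + y ^ m)"
    using assms by simp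
  then show ?thesis
    by (simp only: int_dvd_int_iff)
qed

lemma add_dvd_power_diff_even:
  fixes x y n :: nat
  assumes "even n" "y \<le> x"
  shows "x + y dvd x ^ n - y ^ n"
proof -
  have "int x - (- int y) dvd int x ^ n - (- int y) ^ n"
    by (simp add: power_diff_sumr2)
  then have "int (x + y) dvd int (x ^ n - y ^ n)"
    using assms by (simp add: of_nat_diff power_mono)
  then show ?thesis
    by (simp only: int_dvd_int_iff)
qed

end

theory Submission
  imports Defs "HOL-Analysis.Harmonic_Numbers"
begin

text \<open>
  Write \<open>x = g a\<close>, \<open>y = g b\<close> with \<open>a\<close>, \<open>b\<close> coprime, and let \<open>A\<close>, \<open>B\<close> be the two quotients formed
  with \<open>a\<close>, \<open>b\<close> in place of \<open>x\<close>, \<open>y\<close>. The equation forces \<open>k / \<phi>(k) > x\<close> for the argument \<open>k\<close> of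
  \<open>\<phi>\<close>, so \<open>k\<close> must have many small prime factors. On the other hand, comparing \<open>q\<close>-adic valuations
  shows that at most \<open>1 + v\<^sub>q(B)\<close> prime factors \<open>p\<close> of \<open>A\<close> satisfy \<open>p \<equiv> 1 (mod q)\<close>.

  If \<open>a + b\<close> is odd, \<open>q = 2\<close> leaves at most one odd prime factor of \<open>k\<close>, which only allows
  \<open>x = 2\<close>, \<open>z = 2\<close>. If \<open>a\<close> and \<open>b\<close> are odd, replacing \<open>x\<close>, \<open>y\<close>, \<open>z\<close> by \<open>x\<^sup>d\<close>, \<open>y\<^sup>d\<close>,
  \<open>z (x\<^sup>d + y\<^sup>d) / (x + y)\<close> with \<open>d = gcd m n\<close> makes \<open>m\<close>, \<open>n\<close> coprime. For a prime \<open>q\<close> dividing \<open>m\<close>,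
  \<open>v\<^sub>q(B)\<close> is then bounded independently of \<open>n\<close>, while Zsigmondy's theorem for squarefree divisors
  of \<open>m\<close> gives at least \<open>2\<^sup>r\<^sup>-\<^sup>1\<close> prime factors \<open>p \<equiv> 1 (mod q)\<close> of \<open>A\<close>, where \<open>r\<close> is the number of
  prime factors of \<open>m\<close>. Every prime factor of \<open>A\<close> lies in one of these few classes modulo \<open>2q\<close>,
  which yields \<open>A / \<phi>(A) \<le> a\<^sup>0\<^sup>.\<^sup>3\<^sup>6\<^sup>1\<close>, too small for \<open>k / \<phi>(k) > x\<close>.
\<close>

section \<open>Valuations and orders for sums of odd powers\<close>

text \<open>Since \<open>t\<close> is congruent to \<open>s\<close>, each term of the geometric sum
  for the cofactor \<open>Q\<close> reduces to \<open>s ^ (k - 1)\<close>. Working over the integers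
  lets \<open>t = - b\<close> cover sums of odd powers and differences of even powers at
  once.\<close>

lemma power_diff_quotient_cong:
  fixes s t p Q :: int
  assumes "p dvd s - t" "s \<noteq> t" "s ^ k - t ^ k = (s - t) * Q"
  shows "[Q = int k * s ^ (k - 1)] (mod p)"
proof -
  have "Q = (\<Sum>i<k. t ^ (k - Suc i) * s ^ i)"
    using assms(2,3) power_diff_sumr2[of s k t] by simp
  moreover have "[(\<Sum>i<k. t ^ (k - Suc i) * s ^ i) = (\<Sum>i<k. s ^ (k - 1))] (mod p)"
  proof (rule cong_sum)
    fix i assume "i \<in> {..<k}"
    then have "s ^ (k - Suc i) * s ^ i = s ^ (k - 1)"
      by (simp flip: power_add)
    moreover have "[t = s] (mod p)"
      using assms(1) by (simp add: cong_sym_eq cong_iff_dvd_diff)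
    ultimately show "[t ^ (k - Suc i) * s ^ i = s ^ (k - 1)] (mod p)"
      by (metis cong_mult cong_pow cong_refl)
  qed
  ultimately show ?thesis by simp
qed

text \<open>The binomial expansion of \<open>t = s + (t - s)\<close> cut off after the linear term.
  Precision modulo \<open>p\<^sup>2\<close> is wanted where the cofactor is itself divisible by
  \<open>p\<close>.\<close>

lemma power_diff_first_order:
  fixes s t p :: int
  assumes "p dvd t - s"
  shows "p\<^sup>2 dvd t ^ j - s ^ j - int j * (t - s) * s ^ (j - 1)"
proof (induction j)
  case (Suc j)
  have "p\<^sup>2 dvd (t - s)\<^sup>2" using assms by (simp add: dvd_power_same)
  then have "p\<^sup>2 dvd t * (t ^ j - s ^ j - int j * (t - s) * s ^ (j - 1))
      + int j * (t - s)\<^sup>2 * s ^ (j - 1)"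
    using Suc by (intro dvd_add) auto
  also have "t * (t ^ j - s ^ j - int j * (t - s) * s ^ (j - 1))
      + int j * (t - s)\<^sup>2 * s ^ (j - 1)
      = t ^ Suc j - s ^ Suc j - int (Suc j) * (t - s) * s ^ (Suc j - 1)"
    by (cases j) (auto simp: algebra_simps power2_eq_square)
  finally show ?case .
qed auto

text \<open>Lifting the exponent: the cofactor is congruent to \<open>f * X ^ (f - 1)\<close> modulo
  \<open>p\<close>, so it contributes no factor \<open>p\<close>.\<close>

lemma multiplicity_power_add_coprime:
  fixes p X Y f :: nat
  assumes "prime p" "p dvd X + Y" "\<not> p dvd X" "odd f" "\<not> p dvd f"
  shows "multiplicity p (X ^ f + Y ^ f) = multiplicity p (X + Y)"
proof -
  obtain Q where Q: "X ^ f + Y ^ f = (X + Y) * Q"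
    using add_dvd_power_add_odd[OF assms(4)] by (auto simp: dvd_def)
  have "X > 0" using assms(3) by (cases X) auto
  have "int X ^ f - (- int Y) ^ f = (int X - (- int Y)) * int Q"
    using Q assms(4) by (simp flip: of_nat_add of_nat_mult of_nat_power)
  then have "[int Q = int f * int X ^ (f - 1)] (mod int p)"
    using assms \<open>X > 0\<close>
    by (intro power_diff_quotient_cong[where t = "- int Y"]) (auto simp flip: of_nat_add)
  then have "[Q = f * X ^ (f - 1)] (mod p)"
    by (metis cong_int_iff of_nat_mult of_nat_power)
  moreover have "\<not> p dvd f * X ^ (f - 1)"
    using assms by (auto simp: prime_dvd_mult_iff dest: prime_dvd_power)
  ultimately have "\<not> p dvd Q" using cong_dvd_iff by blast
  moreover have "Q \<noteq> 0" using \<open>\<not> p dvd Q\<close> dvd_0_right by metis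
  ultimately show ?thesis using Q assms \<open>X > 0\<close>
    by (simp add: prime_elem_multiplicity_mult_distrib not_dvd_imp_multiplicity_0)
qed

text \<open>Lifting the exponent at \<open>p\<close> itself. Modulo \<open>p\<^sup>2\<close> the
  cofactor is \<open>p * X ^ (p - 1)\<close>: the linear corrections carry the factor
  \<open>t - s\<close>, divisible by \<open>p\<close>, times \<open>0 + ... + (p - 1)\<close>, which
  an odd \<open>p\<close> divides too.\<close>

lemma multiplicity_power_add_self:
  fixes p X Y :: nat
  assumes "prime p" "odd p" "p dvd X + Y" "\<not> p dvd X"
  shows "multiplicity p (X ^ p + Y ^ p) \<le> multiplicity p (X + Y) + 1"
proof -
  obtain Q where Q: "X ^ p + Y ^ p = (X + Y) * Q"
    using add_dvd_power_add_odd[OF assms(2)] by (auto simp: dvd_def)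
  have "X > 0" using assms(4) by (cases X) auto
  define s t where "s = int X" and "t = - int Y"
  have pts: "int p dvd t - s" "int p dvd s - t" unfolding s_def t_def
    using assms(3) by (auto simp: dvd_diff_commute simp flip: of_nat_add)
  have "s ^ p - t ^ p = (s - t) * int Q" unfolding s_def t_def
    using Q assms(2) by (simp flip: of_nat_add of_nat_mult of_nat_power)
  moreover have "s ^ p - t ^ p = (s - t) * (\<Sum>i<p. s ^ (p - Suc i) * t ^ i)"
    using power_diff_sumr2[of t p s] by (metis minus_diff_eq mult_minus_left)
  moreover have "s - t \<noteq> 0" using \<open>X > 0\<close> by (simp add: s_def t_def)
  ultimately have "int Q = (\<Sum>i<p. s ^ (p - Suc i) * t ^ i)"
    by (metis mult_cancel_left)
  moreover have "[(\<Sum>i<p. s ^ (p - Suc i) * t ^ i)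
      = (\<Sum>i<p. s ^ (p - Suc i) * (s ^ i + int i * (t - s) * s ^ (i - 1)))] (mod (int p)\<^sup>2)"
  proof (intro cong_sum cong_mult cong_refl)
    fix i
    show "[t ^ i = s ^ i + int i * (t - s) * s ^ (i - 1)] (mod (int p)\<^sup>2)"
      using power_diff_first_order[OF pts(1), of i]
      by (simp add: cong_iff_dvd_diff algebra_simps)
  qed
  moreover have "(\<Sum>i<p. s ^ (p - Suc i) * (s ^ i + int i * (t - s) * s ^ (i - 1)))
      = (\<Sum>i<p. s ^ (p - 1) + int i * ((t - s) * s ^ (p - 2)))"
  proof (rule sum.cong)
    fix i assume "i \<in> {..<p}"
    moreover have "s ^ (p - Suc i) * s ^ (i - 1) = s ^ (p - 2)" if "0 < i" "i < p"
      using that by (simp add: numeral_2_eq_2 flip: power_add)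
    ultimately show "s ^ (p - Suc i) * (s ^ i + int i * (t - s) * s ^ (i - 1))
      = s ^ (p - 1) + int i * ((t - s) * s ^ (p - 2))"
      by (cases "i = 0") (auto simp: algebra_simps simp flip: power_add)
  qed auto
  moreover have "\<dots> = int p * s ^ (p - 1) + (\<Sum>i<p. int i) * ((t - s) * s ^ (p - 2))"
    by (simp add: sum.distrib sum_distrib_right)
  moreover have "int p dvd (\<Sum>i<p. int i)"
  proof -
    have "2 * (\<Sum>i<p. int i) = int p * (int p - 1)"
      by (induction p) (auto simp: algebra_simps)
    then have "int p dvd 2 * (\<Sum>i<p. int i)" by simp
    moreover have "coprime (int p) 2" using assms(2) by simp
    ultimately show ?thesis using coprime_dvd_mult_right_iff by blast
  qed
  then have "(int p)\<^sup>2 dvd (\<Sum>i<p. int i) * ((t - s) * s ^ (p - 2))"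
    unfolding power2_eq_square using pts by (intro mult_dvd_mono) auto
  ultimately have *: "[int Q = int p * s ^ (p - 1)] (mod (int p)\<^sup>2)"
    by (metis (no_types, lifting) cong_add_lcancel_0 cong_0_iff cong_trans)
  have nd: "\<not> p\<^sup>2 dvd Q"
  proof
    assume "p\<^sup>2 dvd Q"
    then have "(int p)\<^sup>2 dvd int Q" by (simp flip: of_nat_power)
    then have "(int p)\<^sup>2 dvd int p * s ^ (p - 1)" using * cong_dvd_iff by blast
    then have "int p dvd s ^ (p - 1)" using assms(1)
      by (simp add: power2_eq_square)
    then have "p dvd X ^ (p - 1)" unfolding s_def by (simp flip: of_nat_power)
    then show False using assms prime_dvd_power by blast
  qed
  then have "multiplicity p Q < 2"
    using assms(1) multiplicity_dvd'[of 2 p Q] by (meson not_le)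
  moreover have "Q \<noteq> 0" using nd dvd_0_right by metis
  ultimately show ?thesis using Q assms \<open>X > 0\<close>
    by (simp add: prime_elem_multiplicity_mult_distrib)
qed

text \<open>Take for \<open>o'\<close> the multiplicative order of \<open>-a/b\<close> modulo
  \<open>p\<close>: for odd \<open>k\<close>, \<open>p\<close> divides \<open>a ^ k + b ^ k\<close>
  exactly when \<open>(-a/b) ^ k\<close> is 1.\<close>

lemma odd_power_add_order:
  fixes p a b :: nat
  assumes "prime p" "\<not> p dvd a" "\<not> p dvd b"
  obtains o' where "o' dvd p - 1" "\<And>k. odd k \<Longrightarrow> p dvd a ^ k + b ^ k \<longleftrightarrow> o' dvd k"
proof -
  have "coprime b p" using prime_imp_coprime[OF assms(1,3)] by (rule coprime_imp_coprime) auto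
  then obtain c where c: "[b * c = 1] (mod p)"
    using cong_solve_coprime_nat[of b p] by auto
  \<comment> \<open>A natural number representing \<open>-a/b\<close>: \<open>p - 1\<close> stands
    for -1 and \<open>c\<close> is the inverse of \<open>b\<close>.\<close>
  define u where "u = (p - 1) * a * c"
  have "p > 1" using assms(1) prime_gt_1_nat by simp
  have "[int b * int c = 1] (mod int p)"
    using c by (metis cong_int_iff of_nat_1 of_nat_mult)
  moreover have "[int p - 1 = -1] (mod int p)" by (simp add: cong_iff_dvd_diff)
  ultimately have "[(int p - 1) * int a * (int b * int c) = (-1) * int a * 1] (mod int p)"
    by (intro cong_mult cong_refl)
  moreover have "int u * int b = (int p - 1) * int a * (int b * int c)"
    using \<open>p > 1\<close> by (simp add: u_def of_nat_diff mult_ac)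
  ultimately have ub: "[int u * int b = - int a] (mod int p)"
    by (metis mult_1_right mult_minus1)
  have iff: "p dvd a ^ k + b ^ k \<longleftrightarrow> [u ^ k = 1] (mod p)" if "odd k" for k
  proof -
    have "[(int u * int b) ^ k = - (int a ^ k)] (mod int p)"
      using cong_pow[OF ub, of k] that by simp
    then have "int p dvd - ((int u * int b) ^ k + int a ^ k)"
      by (simp only: cong_iff_dvd_diff dvd_minus_iff diff_minus_eq_add)
    moreover have "- ((int u * int b) ^ k + int a ^ k)
        = - (int b ^ k * (int u ^ k - 1)) - (int a ^ k + int b ^ k)"
      by (simp add: power_mult_distrib algebra_simps)
    ultimately have "[int a ^ k + int b ^ k = - (int b ^ k * (int u ^ k - 1))] (mod int p)"
      by (metis cong_iff_dvd_diff cong_sym)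
    then have "p dvd a ^ k + b ^ k \<longleftrightarrow> int p dvd int b ^ k * (int u ^ k - 1)"
      by (metis cong_dvd_iff dvd_minus_iff of_nat_add of_nat_dvd_iff of_nat_power)
    also have "\<dots> \<longleftrightarrow> int p dvd int u ^ k - 1"
      using assms by (auto simp: prime_dvd_mult_iff dest: prime_dvd_power simp flip: of_nat_power)
    also have "\<dots> \<longleftrightarrow> [u ^ k = 1] (mod p)"
      by (metis cong_iff_dvd_diff cong_int_iff of_nat_1 of_nat_power)
    finally show ?thesis .
  qed
  have "\<not> p dvd u"
  proof
    assume "p dvd u"
    then have "int p dvd int u * int b" by simp
    then have "int p dvd - int a" using ub cong_dvd_iff by blast
    then show False using assms by simp
  qed
  then have "[u ^ (p - 1) = 1] (mod p)" using assms(1) fermat_theorem by blast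
  then have "ord p u dvd p - 1" by (simp only: ord_divides)
  with iff show ?thesis by (intro that[of "ord p u"]) (simp_all only: ord_divides)
qed

section \<open>Zsigmondy's theorem for squarefree odd exponents\<close>

text \<open>Pairing each \<open>T\<close> with \<open>insert s T\<close> peels one element off the
  Moebius-type sum and leaves differences, which vanish or simplify when \<open>s\<close> hardly
  affects \<open>f\<close>.\<close>

lemma signed_Pow_sum_insert:
  fixes f :: "'a set \<Rightarrow> real"
  assumes "finite S" "s \<notin> S"
  shows "(\<Sum>T\<in>Pow (insert s S). (-1) ^ (card (insert s S) - card T) * f T)
       = (\<Sum>T\<in>Pow S. (-1) ^ (card S - card T) * (f (insert s T) - f T))"
proof -
  have "(\<Sum>T\<in>Pow (insert s S). (-1) ^ (card (insert s S) - card T) * f T)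
      = (\<Sum>T\<in>Pow S. (-1) ^ (card (insert s S) - card T) * f T)
      + (\<Sum>T\<in>insert s ` Pow S. (-1) ^ (card (insert s S) - card T) * f T)"
    unfolding Pow_insert by (rule sum.union_disjoint) (use assms in auto)
  also have "(\<Sum>T\<in>insert s ` Pow S. (-1) ^ (card (insert s S) - card T) * f T)
      = (\<Sum>T\<in>Pow S. (-1) ^ (card (insert s S) - card (insert s T)) * f (insert s T))"
    by (subst sum.reindex) (use assms in \<open>auto intro!: inj_onI simp: o_def\<close>)
  also have "(\<Sum>T\<in>Pow S. (-1) ^ (card (insert s S) - card T) * f T) + \<dots>
      = (\<Sum>T\<in>Pow S. (-1) ^ (card S - card T) * (f (insert s T) - f T))"
    unfolding sum.distrib[symmetric]
  proof (rule sum.cong)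
    fix T assume "T \<in> Pow S"
    then have "finite T" "s \<notin> T" "card T \<le> card S"
      using assms finite_subset card_mono by auto
    then show "(-1) ^ (card (insert s S) - card T) * f T
        + (-1) ^ (card (insert s S) - card (insert s T)) * f (insert s T)
        = (-1) ^ (card S - card T) * (f (insert s T) - f T)"
      using assms by (simp add: Suc_diff_le algebra_simps)
  qed auto
  finally show ?thesis .
qed

lemma signed_Pow_sum_toggle:
  fixes f :: "'a set \<Rightarrow> real"
  assumes "finite S" "s \<in> S" "\<And>T. T \<subseteq> S - {s} \<Longrightarrow> f (insert s T) = f T"
  shows "(\<Sum>T\<in>Pow S. (-1) ^ (card S - card T) * f T) = 0"
proof -
  have "insert s (S - {s}) = S" using assms(2) by auto
  then show ?thesis
    using signed_Pow_sum_insert[of "S - {s}" s f] assms by simp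
qed

lemma odd_prod_odd_set:
  fixes S :: "nat set"
  assumes "\<And>s. s \<in> S \<Longrightarrow> odd s"
  shows "odd (\<Prod>S)"
  using assms by (induction S rule: infinite_finite_induct) auto

lemma prime_dvd_prod_primes:
  fixes S :: "nat set"
  assumes "finite S" "\<And>s. s \<in> S \<Longrightarrow> prime s" "prime p" "p dvd \<Prod>S"
  shows "p \<in> S"
  using assms by (metis prime_dvd_prod_iff primes_dvd_imp_eq)

lemma prod_primes_inject:
  fixes S T :: "nat set"
  assumes "finite S" "finite T" "\<And>s. s \<in> S \<union> T \<Longrightarrow> prime s" "\<Prod>S = \<Prod>T"
  shows "S = T"
proof -
  have "S \<subseteq> T" if "finite S" "finite T" "\<And>s. s \<in> S \<union> T \<Longrightarrow> prime s" "\<Prod>S = \<Prod>T" for S T :: "nat set"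
  proof
    fix s assume "s \<in> S"
    with that(1) have "s dvd \<Prod>S" by (rule dvd_prodI)
    then show "s \<in> T" using that \<open>s \<in> S\<close> by (intro prime_dvd_prod_primes) auto
  qed
  from this[of S T] this[of T S] show ?thesis using assms by auto
qed

lemma prod_primes_dvd:
  fixes S :: "nat set"
  assumes "finite S" "\<And>s. s \<in> S \<Longrightarrow> prime s" "\<And>s. s \<in> S \<Longrightarrow> s dvd k"
  shows "\<Prod>S dvd k"
  using assms
proof (induction S rule: finite_induct)
  case (insert s S)
  then have "\<not> s dvd \<Prod>S" using prime_dvd_prod_primes[of S s] by auto
  then have "coprime s (\<Prod>S)" using insert by (intro prime_imp_coprime) auto
  then show ?case using insert by (simp add: divides_mult)
qed auto

lemma prime_dvd_power_add_coprime:
  fixes a b k p :: nat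
  assumes "prime p" "p dvd a ^ k + b ^ k" "coprime a b" "k > 0"
  shows "\<not> p dvd a" "\<not> p dvd b"
proof -
  have "p dvd a ^ k \<longleftrightarrow> p dvd a" "p dvd b ^ k \<longleftrightarrow> p dvd b"
    using assms by (auto simp: prime_dvd_power_iff)
  then have "p dvd a \<longleftrightarrow> p dvd b"
    using assms(2) by (metis dvd_add_right_iff dvd_add_left_iff)
  moreover have "\<not> (p dvd a \<and> p dvd b)"
    using assms(1,3) by (metis coprime_common_divisor not_prime_unit)
  ultimately show "\<not> p dvd a" "\<not> p dvd b" by auto
qed

context
  fixes a b :: nat and S :: "nat set"
  assumes ab: "coprime a b" "a > 0" "b > 0"
  and S: "finite S" "\<And>s. s \<in> S \<Longrightarrow> prime s" "\<And>s. s \<in> S \<Longrightarrow> odd s"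
begin

definition signed_multiplicity :: "nat \<Rightarrow> real" where
  "signed_multiplicity p = (\<Sum>T\<in>Pow S. (-1) ^ (card S - card T) * real (multiplicity p (a ^ \<Prod>T + b ^ \<Prod>T)))"

lemma subset_prod:
  assumes "T \<subseteq> S"
  shows "finite T" "odd (\<Prod>T)" "\<Prod>T > 0"
proof -
  show "finite T" using assms S(1) finite_subset by auto
  show "odd (\<Prod>T)" using assms S by (intro odd_prod_odd_set) auto
  then show "\<Prod>T > 0" by (rule odd_pos)
qed

text \<open>
  The signed multiplicity of \<open>p\<close> is its exponent in the value of the homogenised cyclotomic polynomial
  of index \<open>2 \<Prod>S\<close>, which is thereby never constructed. Toggling a prime \<open>s \<noteq> p\<close> outside the order of
  \<open>p\<close> does not change the multiplicity, so the signed sum cancels.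
\<close>

lemma signed_multiplicity_toggle:
  assumes p: "prime p" "\<not> p dvd a"
    and o': "\<And>k. odd k \<Longrightarrow> p dvd a ^ k + b ^ k \<longleftrightarrow> o' dvd k"
    and s: "s \<in> S" "s \<noteq> p" "coprime o' s"
  shows "signed_multiplicity p = 0"
  unfolding signed_multiplicity_def
proof (rule signed_Pow_sum_toggle[OF S(1) s(1)])
  fix T assume T: "T \<subseteq> S - {s}"
  then have TS: "T \<subseteq> S" "insert s T \<subseteq> S" "s \<notin> T" using s by auto
  have prod: "\<Prod>(insert s T) = \<Prod>T * s"
    using TS subset_prod(1)[OF TS(1)] by (simp add: mult.commute)
  show "real (multiplicity p (a ^ \<Prod>(insert s T) + b ^ \<Prod>(insert s T)))
      = real (multiplicity p (a ^ \<Prod>T + b ^ \<Prod>T))"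
  proof (cases "o' dvd \<Prod>T")
    case True
    then have "p dvd a ^ \<Prod>T + b ^ \<Prod>T" using o' subset_prod[OF TS(1)] by auto
    moreover have "\<not> p dvd s" using s S(2) p(1) primes_dvd_imp_eq by blast
    moreover have "\<not> p dvd a ^ \<Prod>T" using p prime_dvd_power by blast
    ultimately have "multiplicity p ((a ^ \<Prod>T) ^ s + (b ^ \<Prod>T) ^ s)
        = multiplicity p (a ^ \<Prod>T + b ^ \<Prod>T)"
      using p S(3) s(1) by (intro multiplicity_power_add_coprime) auto
    then show ?thesis by (simp only: prod power_mult)
  next
    case False
    then have "\<not> o' dvd \<Prod>(insert s T)"
      using s(3) prod by (simp add: coprime_dvd_mult_left_iff)
    then have "\<not> p dvd a ^ \<Prod>(insert s T) + b ^ \<Prod>(insert s T)"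
      "\<not> p dvd a ^ \<Prod>T + b ^ \<Prod>T"
      using False o' subset_prod(2)[OF TS(1)] subset_prod(2)[OF TS(2)] by blast+
    from this[THEN not_dvd_imp_multiplicity_0] show ?thesis by simp
  qed
qed

text \<open>Any \<open>s\<close> in \<open>S\<close> outside \<open>T0\<close> is coprime to the
  order \<open>o'\<close>, so toggling it cancels the sum unless \<open>s = p\<close>. In the
  remaining case all other primes of \<open>S\<close> divide \<open>o'\<close>, hence
  \<open>p - 1\<close>, so \<open>p\<close> is the largest element and \<open>o'\<close> is the
  product over \<open>S - {p}\<close>. Then only \<open>S - {p}\<close> and \<open>S\<close> itself
  contribute, and lifting the exponent at \<open>p\<close> bounds their difference by 1.\<close>

lemma signed_multiplicity_le:
  assumes p: "prime p" and T0: "T0 \<subset> S" "p dvd a ^ \<Prod>T0 + b ^ \<Prod>T0"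
  shows "signed_multiplicity p \<le> (if p = Max S then 1 else 0)"
proof -
  have pab: "\<not> p dvd a \<and> \<not> p dvd b"
    using prime_dvd_power_add_coprime[OF p T0(2) ab(1)] subset_prod(3)[of T0] T0(1) by auto
  obtain o' where o'1: "o' dvd p - 1"
    and o': "\<And>k. odd k \<Longrightarrow> p dvd a ^ k + b ^ k \<longleftrightarrow> o' dvd k"
    using odd_power_add_order[OF p] pab by blast
  obtain s where s: "s \<in> S" "s \<notin> T0" using T0 by auto
  have oT0: "o' dvd \<Prod>T0" using o' T0 subset_prod[of T0] by auto
  have "T0 \<subseteq> S - {s}" using T0 s by auto
  then have "\<Prod>T0 dvd \<Prod>(S - {s})" using S(1) by (intro prod_dvd_prod_subset) auto
  with oT0 have os: "o' dvd \<Prod>(S - {s})" by (rule dvd_trans)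
  have cop: "coprime o' s" if "o' dvd \<Prod>(U - {s})" "s \<in> U" "U \<subseteq> S" for s U
  proof -
    have "prime s" "finite U" using that S finite_subset by auto
    have "\<not> s dvd \<Prod>(U - {s})"
      using prime_dvd_prod_primes[of "U - {s}" s] \<open>prime s\<close> \<open>finite U\<close> that S by auto
    then show ?thesis using \<open>prime s\<close> that(1)
      by (metis coprime_commute dvd_trans prime_imp_coprime)
  qed
  show ?thesis
  proof (cases "\<exists>t\<in>S. t \<noteq> p \<and> coprime o' t")
    case True
    then show ?thesis using signed_multiplicity_toggle[OF p _ o'] pab by auto
  next
    case False
    then have sp: "s = p" using s cop[OF os s(1)] by blast
    define U where "U = S - {p}"
    have U: "finite U" "p \<notin> U" "insert p U = S" "U \<subseteq> S" using S s sp by (auto simp: U_def)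
    have dvdo: "t dvd o'" if "t \<in> U" for t
      using False that S by (metis U_def DiffE coprime_commute insertI1 prime_imp_coprime singletonD)
    have Uo: "\<Prod>U dvd o'" using U S dvdo by (intro prod_primes_dvd) auto
    have "o' = \<Prod>U" using Uo os sp by (simp add: U_def dvd_antisym)
    have p1: "p > 1" using p prime_gt_1_nat by auto
    have "t < p" if "t \<in> U" for t
    proof -
      have "t \<le> p - 1" using dvdo[OF that] o'1 p1 by (meson dvd_imp_le dvd_trans zero_less_diff)
      then show ?thesis using p1 by simp
    qed
    then have "p = Max S" using U s sp S by (intro Max_eqI[symmetric]) force+
    have "signed_multiplicity p = (\<Sum>T\<in>Pow U. (-1) ^ (card U - card T) *
        (real (multiplicity p (a ^ \<Prod>(insert p T) + b ^ \<Prod>(insert p T)))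
          - real (multiplicity p (a ^ \<Prod>T + b ^ \<Prod>T))))"
      unfolding signed_multiplicity_def
      using signed_Pow_sum_insert[OF U(1,2), where
          f = "\<lambda>T. real (multiplicity p (a ^ \<Prod>T + b ^ \<Prod>T))"] U(3) by simp
    also have "\<dots> = (\<Sum>T\<in>{U}. (-1) ^ (card U - card T) *
        (real (multiplicity p (a ^ \<Prod>(insert p T) + b ^ \<Prod>(insert p T)))
          - real (multiplicity p (a ^ \<Prod>T + b ^ \<Prod>T))))"
    proof (rule sum.mono_neutral_right)
      show "\<forall>T\<in>Pow U - {U}. (-1) ^ (card U - card T) *
        (real (multiplicity p (a ^ \<Prod>(insert p T) + b ^ \<Prod>(insert p T)))
          - real (multiplicity p (a ^ \<Prod>T + b ^ \<Prod>T))) = 0"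
      proof
        fix T assume T: "T \<in> Pow U - {U}"
        then obtain t where t: "t \<in> U" "t \<notin> T" by auto
        have TS: "insert p T \<subseteq> S" "T \<subseteq> S" using T U by auto
        have n1: "\<not> t dvd \<Prod>(insert p T)"
          using prime_dvd_prod_primes[of "insert p T" t] S t U TS subset_prod(1)[OF TS(1)] by blast
        have n2: "\<not> t dvd \<Prod>T"
          using prime_dvd_prod_primes[of T t] S t U TS subset_prod(1)[OF TS(2)] by blast
        have "\<not> o' dvd \<Prod>(insert p T)" "\<not> o' dvd \<Prod>T"
          using n1 n2 dvdo[OF t(1)] dvd_trans by blast+
        then have "\<not> p dvd a ^ \<Prod>(insert p T) + b ^ \<Prod>(insert p T)"
          "\<not> p dvd a ^ \<Prod>T + b ^ \<Prod>T"
          using o' subset_prod(2)[OF TS(1)] subset_prod(2)[OF TS(2)] by blast+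
        from this[THEN not_dvd_imp_multiplicity_0] show "(-1) ^ (card U - card T) *
          (real (multiplicity p (a ^ \<Prod>(insert p T) + b ^ \<Prod>(insert p T)))
            - real (multiplicity p (a ^ \<Prod>T + b ^ \<Prod>T))) = 0"
          by simp
      qed
    qed (use U in auto)
    also have "\<dots> = real (multiplicity p (a ^ \<Prod>(insert p U) + b ^ \<Prod>(insert p U)))
          - real (multiplicity p (a ^ \<Prod>U + b ^ \<Prod>U))" by simp
    also have "\<dots> \<le> 1"
    proof -
      have "p dvd a ^ \<Prod>U + b ^ \<Prod>U" using o' subset_prod[OF U(4)] \<open>o' = \<Prod>U\<close> by auto
      moreover have "\<not> p dvd a ^ \<Prod>U" using pab p prime_dvd_power by blast
      moreover have "odd p" using s sp S by auto
      moreover have "\<Prod>(insert p U) = \<Prod>U * p" using U(1,2) by (simp add: mult.commute)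
      ultimately show ?thesis
        using multiplicity_power_add_self[of p "a ^ \<Prod>U" "b ^ \<Prod>U"] p
        by (simp add: power_mult)
    qed
    finally show ?thesis using \<open>p = Max S\<close> by simp
  qed
qed

text \<open>Without a primitive prime, only \<open>Max S\<close> can contribute positively to the
  signed sum of logarithms, so this sum is at most \<open>ln (Max S)\<close>. Its size, roughly the
  product of all \<open>s - 1\<close> times \<open>ln a\<close>, is larger.\<close>

lemma primitive_prime_divisor:
  assumes "b < a" "a \<ge> 3" "S \<noteq> {}"
  obtains p where "prime p" "p dvd a ^ \<Prod>S + b ^ \<Prod>S"
    "\<And>T. T \<subset> S \<Longrightarrow> \<not> p dvd a ^ \<Prod>T + b ^ \<Prod>T"
proof (rule ccontr)
  assume "\<not> thesis"
  then have nonprim: "\<exists>T. T \<subset> S \<and> p dvd a ^ \<Prod>T + b ^ \<Prod>T"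
    if "prime p" "p dvd a ^ \<Prod>S + b ^ \<Prod>S" for p
    using that \<open>\<And>p. prime p \<Longrightarrow> p dvd a ^ \<Prod>S + b ^ \<Prod>S \<Longrightarrow>
      (\<And>T. T \<subset> S \<Longrightarrow> \<not> p dvd a ^ \<Prod>T + b ^ \<Prod>T) \<Longrightarrow> thesis\<close> by blast
  define G where "G = (\<lambda>T::nat set. a ^ \<Prod>T + b ^ \<Prod>T)"
  define sg where "sg = (\<lambda>T::nat set. (-1::real) ^ (card S - card T))"
  define P where "P = (\<Union>T\<in>Pow S. prime_factors (G T))"
  have finP: "finite P" unfolding P_def using S(1) by auto
  have Gpos: "G T > 0" for T unfolding G_def using ab by simp
  have Max: "Max S \<in> S" using assms(3) S(1) by simp
  have Max3: "Max S \<ge> 3" using S(2,3)[OF Max] prime_ge_2_nat[of "Max S"]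
    by (cases "Max S = 2") auto
  have le: "signed_multiplicity p \<le> (if p = Max S then 1 else 0)" if "p \<in> P" for p
  proof -
    obtain T where T: "T \<subseteq> S" "prime p" "p dvd G T"
      using \<open>p \<in> P\<close> by (auto simp: P_def)
    show ?thesis
    proof (cases "T = S")
      case True
      then show ?thesis using nonprim[of p] signed_multiplicity_le[of p] T unfolding G_def by blast
    next
      case False
      then show ?thesis using signed_multiplicity_le[of p T] T unfolding G_def by blast
    qed
  qed
  have ln_eq: "ln (real (G T)) = (\<Sum>p\<in>P. real (multiplicity p (G T)) * ln (real p))"
    if "T \<in> Pow S" for T
  proof -
    have "ln (real (G T)) = ln (\<Prod>p\<in>prime_factors (G T). real p ^ multiplicity p (G T))"
      by (subst prime_factorization_nat[OF Gpos[of T]]) simp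
    also have "\<dots> = (\<Sum>p\<in>prime_factors (G T). real (multiplicity p (G T)) * ln (real p))"
      by (subst ln_prod) (auto simp: ln_realpow in_prime_factors_iff intro!: sum.cong dest: prime_gt_0_nat)
    also have "\<dots> = (\<Sum>p\<in>P. real (multiplicity p (G T)) * ln (real p))"
    proof (rule sum.mono_neutral_left[OF finP])
      show "\<forall>p\<in>P - prime_factors (G T). real (multiplicity p (G T)) * ln (real p) = 0"
        using Gpos[of T] by (auto simp: P_def in_prime_factors_iff not_dvd_imp_multiplicity_0)
    qed (use that in \<open>auto simp: P_def\<close>)
    finally show ?thesis .
  qed
  have "(\<Sum>T\<in>Pow S. sg T * ln (real (G T)))
      = (\<Sum>T\<in>Pow S. \<Sum>p\<in>P. sg T * real (multiplicity p (G T)) * ln (real p))"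
    by (intro sum.cong refl) (simp add: ln_eq sum_distrib_left mult.assoc)
  also have "\<dots> = (\<Sum>p\<in>P. signed_multiplicity p * ln (real p))"
    unfolding signed_multiplicity_def sum_distrib_right
    by (subst sum.swap) (simp add: sg_def G_def)
  also have "\<dots> \<le> (\<Sum>p\<in>P. if p = Max S then ln (real (Max S)) else 0)"
  proof (rule sum_mono)
    fix p assume p: "p \<in> P"
    then have "ln (real p) \<ge> 0" by (auto simp: P_def in_prime_factors_iff dest: prime_gt_0_nat)
    then show "signed_multiplicity p * ln (real p) \<le> (if p = Max S then ln (real (Max S)) else 0)"
      using mult_right_mono[OF le[OF p], of "ln (real p)"] by (auto split: if_splits)
  qed
  also have "\<dots> \<le> ln (real (Max S))"
    using finP Max3 by simp
  finally have upper: "(\<Sum>T\<in>Pow S. sg T * ln (real (G T))) \<le> ln (real (Max S))" .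

  \<comment> \<open>The number of subsets of \<open>S\<close> that enter with sign -1.\<close>
  define w :: real where "w = 2 ^ (card S - 1)"
  have w1: "w \<ge> 1" by (simp add: w_def)
  have cardS: "card S > 0" using S(1) assms(3) by (simp add: card_gt_0_iff)
  have sg_prod: "(\<Sum>T\<in>Pow S. sg T * real (\<Prod>T)) = (\<Prod>s\<in>S. real s - 1)"
    using prod_diff_conv_sum'[OF S(1), of real "\<lambda>_. 1"] by (simp add: sg_def)
  have sg_0: "(\<Sum>T\<in>Pow S. sg T) = 0"
    using signed_Pow_sum_toggle[OF S(1) Max, of "\<lambda>_. 1"] by (simp add: sg_def)
  \<comment> \<open>Replacing \<open>ln (G T)\<close> by its leading term
    \<open>\<Prod>T * ln a\<close> makes an error between 0 and \<open>ln 2\<close>. The coefficient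
    \<open>(sg T - 1) / 2\<close> is 0 or -1, so the loss is charged only to subsets of negative
    sign.\<close>
  have "(\<Sum>T\<in>Pow S. sg T * (real (\<Prod>T) * ln (real a)) + (sg T - 1) / 2 * ln 2)
      \<le> (\<Sum>T\<in>Pow S. sg T * ln (real (G T)))"
  proof (rule sum_mono)
    fix T
    define \<delta> where "\<delta> = ln (real (G T)) - real (\<Prod>T) * ln (real a)"
    have "b ^ \<Prod>T \<le> a ^ \<Prod>T" using assms by (intro power_mono) auto
    then have "a ^ \<Prod>T \<le> G T" "G T \<le> 2 * a ^ \<Prod>T" by (auto simp: G_def)
    from this[THEN of_nat_mono[where 'a = real]]
    have "real a ^ \<Prod>T \<le> real (G T)" "real (G T) \<le> 2 * real a ^ \<Prod>T"
      by (simp_all only: of_nat_power of_nat_mult of_nat_numeral)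
    then have "ln (real a ^ \<Prod>T) \<le> ln (real (G T))" "ln (real (G T)) \<le> ln (2 * real a ^ \<Prod>T)"
      using ab Gpos[of T] by simp_all
    moreover have "ln (2 * real a ^ \<Prod>T) = ln 2 + real (\<Prod>T) * ln (real a)"
      using ab by (simp add: ln_mult ln_realpow del: of_nat_prod)
    moreover have "ln (real a ^ \<Prod>T) = real (\<Prod>T) * ln (real a)"
      using ab by (simp add: ln_realpow del: of_nat_prod)
    ultimately have "0 \<le> \<delta>" "\<delta> \<le> ln 2" by (simp_all add: \<delta>_def)
    moreover have "sg T = 1 \<or> sg T = -1" 
      unfolding sg_def by (cases "even (card S - card T)") simp_all
    ultimately have "(sg T - 1) / 2 * ln 2 \<le> sg T * \<delta>" by auto
    then show "sg T * (real (\<Prod>T) * ln (real a)) + (sg T - 1) / 2 * ln 2 \<le> sg T * ln (real (G T))"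
      by (simp add: \<delta>_def algebra_simps)
  qed
  also have "(\<Sum>T\<in>Pow S. sg T * (real (\<Prod>T) * ln (real a)) + (sg T - 1) / 2 * ln 2)
      = (\<Sum>T\<in>Pow S. sg T * real (\<Prod>T) * ln (real a) + (sg T - 1) * (ln 2 / 2))"
    by (intro sum.cong refl) (simp del: of_nat_prod)
  also have "\<dots> = (\<Sum>T\<in>Pow S. sg T * real (\<Prod>T)) * ln (real a)
      + ((\<Sum>T\<in>Pow S. sg T) - 2 ^ card S) * (ln 2 / 2)"
    using S(1) unfolding sum.distrib sum_distrib_right[symmetric] sum_subtractf
    by (simp add: card_Pow)
  also have "\<dots> = (\<Prod>s\<in>S. real s - 1) * ln (real a) - w * ln 2"
    unfolding sg_prod sg_0 w_def using cardS by (cases "card S") auto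
  finally have lower: "(\<Prod>s\<in>S. real s - 1) * ln (real a) - w * ln 2
      \<le> (\<Sum>T\<in>Pow S. sg T * ln (real (G T)))" .

  have ge3: "real s - 1 \<ge> 2" if "s \<in> S" for s
    using S(2,3)[OF that] prime_ge_2_nat[of s] by (cases "s = 2") auto
  have "(\<Prod>s\<in>S. real s - 1) = (real (Max S) - 1) * (\<Prod>s\<in>S - {Max S}. real s - 1)"
    using S(1) Max by (rule prod.remove)
  also have "\<dots> \<ge> (real (Max S) - 1) * w"
  proof (rule mult_left_mono)
    have "w = (\<Prod>s\<in>S - {Max S}. 2)" using S(1) Max by (simp add: w_def)
    also have "\<dots> \<le> (\<Prod>s\<in>S - {Max S}. real s - 1)"
      using ge3 by (intro prod_mono) auto
    finally show "w \<le> (\<Prod>s\<in>S - {Max S}. real s - 1)" .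
  qed (use Max3 in auto)
  finally have prod_ge: "(real (Max S) - 1) * w \<le> (\<Prod>s\<in>S. real s - 1)" .
  \<comment> \<open>With \<open>j = Max S - 3\<close> this is the inequality that beats
    \<open>ln (Max S)\<close> already at the smallest admissible base 3.\<close>
  have pow: "2 * (real j + 3) < 3 ^ (j + 2)" for j
    by (induction j) (auto simp: algebra_simps)
  have "2 * real (Max S) < 3 ^ (Max S - 1)"
    using pow[of "Max S - 3"] Max3 by (simp add: of_nat_diff numeral_3_eq_3 Suc_diff_Suc eval_nat_numeral)
  then have "ln (2 * real (Max S)) < ln (3 ^ (Max S - 1))" using Max3 by simp
  then have *: "ln 2 + ln (real (Max S)) < (real (Max S) - 1) * ln 3"
    using Max3 by (simp add: ln_mult ln_realpow of_nat_diff)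
  have "w * ln (real (Max S)) < w * ((real (Max S) - 1) * ln 3 - ln 2)"
    using * w1 by (intro mult_strict_left_mono) auto
  also have "\<dots> \<le> (real (Max S) - 1) * w * ln (real a) - w * ln 2"
  proof -
    have "w * ((real (Max S) - 1) * ln 3) \<le> w * ((real (Max S) - 1) * ln (real a))"
      using assms(2) Max3 w1 by (intro mult_left_mono) auto
    then show ?thesis by (simp add: algebra_simps)
  qed
  also have "\<dots> \<le> (\<Prod>s\<in>S. real s - 1) * ln (real a) - w * ln 2"
    using prod_ge assms(2) by (simp add: mult_right_mono)
  also have "\<dots> \<le> ln (real (Max S))" using lower upper by simp
  also have "\<dots> \<le> w * ln (real (Max S))"
    using w1 Max3 by (simp add: mult_le_cancel_right1)
  finally show False by simp
qed

text \<open>The order of \<open>-a/b\<close> modulo a primitive prime is all of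
  \<open>\<Prod>S\<close>: if some \<open>s\<close> were missing from it, \<open>p\<close> would
  already divide the value at \<open>S - {s}\<close>. Distinct sets \<open>S\<close> therefore yield
  distinct primes.\<close>

lemma prime_of_order_prod:
  assumes "b < a" "a \<ge> 3" "S \<noteq> {}"
  obtains p where "prime p" "\<Prod>S dvd p - 1"
    "\<And>k. odd k \<Longrightarrow> p dvd a ^ k + b ^ k \<longleftrightarrow> \<Prod>S dvd k"
proof -
  obtain p where p: "prime p" "p dvd a ^ \<Prod>S + b ^ \<Prod>S"
    "\<And>T. T \<subset> S \<Longrightarrow> \<not> p dvd a ^ \<Prod>T + b ^ \<Prod>T"
    using primitive_prime_divisor[OF assms] by blast
  have "\<not> p dvd a" "\<not> p dvd b"
    using prime_dvd_power_add_coprime[OF p(1,2) ab(1)] subset_prod(3)[of S] by auto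
  then obtain o' where o': "o' dvd p - 1" "\<And>k. odd k \<Longrightarrow> p dvd a ^ k + b ^ k \<longleftrightarrow> o' dvd k"
    using odd_power_add_order[OF p(1)] by blast
  have "o' dvd \<Prod>S" using o' p(2) subset_prod(2)[of S] by auto
  moreover have "\<Prod>S dvd o'"
  proof (rule prod_primes_dvd[OF S(1,2)])
    fix s assume s: "s \<in> S"
    show "s dvd o'"
    proof (rule ccontr)
      assume "\<not> s dvd o'"
      then have "coprime o' s"
        using prime_imp_coprime[OF S(2)[OF s]] coprime_commute by blast
      moreover have "\<Prod>S = s * \<Prod>(S - {s})" using S(1) s by (rule prod.remove)
      ultimately have "o' dvd \<Prod>(S - {s})"
        using \<open>o' dvd \<Prod>S\<close> by (metis coprime_dvd_mult_right_iff)
      then have "p dvd a ^ \<Prod>(S - {s}) + b ^ \<Prod>(S - {s})"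
        using o' subset_prod(2)[of "S - {s}"] by auto
      moreover have "S - {s} \<subset> S" using s by auto
      ultimately show False using p(3) by blast
    qed
  qed
  ultimately have "o' = \<Prod>S" by (rule dvd_antisym)
  then show ?thesis using that[OF p(1)] o' by blast
qed

end

section \<open>The ratio of a number to its totient\<close>

text \<open>In the product of the \<open>p ^ (e - 1) * (p - 1)\<close>, the prime \<open>q\<close>
  itself loses at most one of its factors, while each prime \<open>p\<close> congruent to 1 modulo
  \<open>q\<close> supplies a new one.\<close>

lemma multiplicity_totient_ge:
  fixes q k :: nat
  assumes "prime q" "k > 0"
  shows "multiplicity q k + card {p \<in> prime_factors k. q dvd p - 1}
    \<le> 1 + multiplicity q (totient k)"
proof -
  let ?P = "prime_factors k"
  have pos: "p ^ (multiplicity p k - 1) * (p - 1) \<noteq> 0" if "p \<in> ?P" for p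
    using that by (auto simp: in_prime_factors_iff dest: prime_gt_1_nat)
  have term_ge: "(if p = q then multiplicity q k - 1 else 0) + (if q dvd p - 1 then 1 else 0)
      \<le> multiplicity q (p ^ (multiplicity p k - 1) * (p - 1))" if p: "p \<in> ?P" for p
  proof -
    have "prime p" "p > 1" using p by (auto simp: in_prime_factors_iff dest: prime_gt_1_nat)
    have "multiplicity q (p ^ (multiplicity p k - 1) * (p - 1))
        = (multiplicity p k - 1) * multiplicity q p + multiplicity q (p - 1)"
      using pos[OF p] assms(1)
      by (simp add: prime_elem_multiplicity_mult_distrib prime_elem_multiplicity_power_distrib)
    moreover have "multiplicity q (p - 1) \<ge> 1" if "q dvd p - 1"
      using that \<open>p > 1\<close> assms(1) by (intro multiplicity_geI) (auto simp: not_prime_unit)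
    moreover have "multiplicity q q = 1" using assms(1) by simp
    ultimately show ?thesis by auto
  qed
  have "multiplicity q k - 1 \<le> (\<Sum>p\<in>?P. if p = q then multiplicity q k - 1 else 0)"
    using assms by (cases "q dvd k") (auto simp: sum.delta in_prime_factors_iff not_dvd_imp_multiplicity_0)
  moreover have "card {p \<in> ?P. q dvd p - 1} = (\<Sum>p\<in>?P. if q dvd p - 1 then 1 else 0)"
    by (simp add: sum.If_cases Int_def)
  ultimately have "multiplicity q k - 1 + card {p \<in> ?P. q dvd p - 1}
      \<le> (\<Sum>p\<in>?P. (if p = q then multiplicity q k - 1 else 0) + (if q dvd p - 1 then 1 else 0))"
    by (simp only: sum.distrib)
  also have "\<dots> \<le> (\<Sum>p\<in>?P. multiplicity q (p ^ (multiplicity p k - 1) * (p - 1)))"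
    by (intro sum_mono term_ge)
  also have "\<dots> = multiplicity q (totient k)"
    unfolding totient_formula1[OF assms(2)] using pos assms(1)
    by (subst prime_elem_multiplicity_prod_distrib) auto
  finally show ?thesis by simp
qed

definition totient_ratio :: "nat \<Rightarrow> real" where
  "totient_ratio k = (\<Prod>p\<in>prime_factors k. real p / (real p - 1))"

lemma prime_factor_gt_1: "p \<in> prime_factors (k::nat) \<Longrightarrow> p > 1"
  by (auto simp: in_prime_factors_iff dest: prime_gt_1_nat)

lemma totient_ratio_eq: "real k = totient_ratio k * real (totient k)"
proof -
  have "totient_ratio k * (\<Prod>p\<in>prime_factors k. 1 - 1 / real p)
      = (\<Prod>p\<in>prime_factors k. real p / (real p - 1) * (1 - 1 / real p))"
    unfolding totient_ratio_def by (rule prod.distrib[symmetric])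
  also have "\<dots> = (\<Prod>p\<in>prime_factors k. 1)"
    by (intro prod.cong refl) (auto dest!: prime_factor_gt_1 simp: field_simps)
  finally show ?thesis unfolding totient_formula2 by (simp add: mult.left_commute)
qed

lemma prod_ratio_ge_1:
  assumes "\<And>p. p \<in> P \<Longrightarrow> p > (1::nat)"
  shows "(\<Prod>p\<in>P. real p / (real p - 1)) \<ge> 1"
  using assms by (intro prod_ge_1) (auto simp: field_simps)

lemma totient_ratio_mult_le:
  assumes "k > 0" "l > 0"
  shows "totient_ratio (k * l) \<le> totient_ratio k * totient_ratio l"
proof -
  let ?f = "\<lambda>p. real p / (real p - 1)"
  have "totient_ratio (k * l) = prod ?f (prime_factors k \<union> prime_factors l)"
    using assms by (simp add: totient_ratio_def prime_factors_product)
  also have "\<dots> \<le> prod ?f (prime_factors k \<union> prime_factors l) * prod ?f (prime_factors k \<inter> prime_factors l)"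
    using prod_ratio_ge_1[of "prime_factors k \<inter> prime_factors l"]
      prod_ratio_ge_1[of "prime_factors k \<union> prime_factors l"] 
    by (smt (verit) IntE UnE mult_le_cancel_left1 prime_factor_gt_1)
  also have "\<dots> = totient_ratio k * totient_ratio l"
    unfolding totient_ratio_def by (rule prod.union_inter) auto
  finally show ?thesis .
qed

lemma prod_prime_factors_le: "k > 0 \<Longrightarrow> \<Prod>(prime_factors k) \<le> (k::nat)"
proof -
  assume "k > 0"
  have "\<Prod>(prime_factors k) dvd (\<Prod>p\<in>prime_factors k. p ^ multiplicity p k)"
    by (intro prod_dvd_prod) (auto simp: prime_factors_multiplicity)
  then show ?thesis using prime_factorization_nat[OF \<open>k > 0\<close>] \<open>k > 0\<close> by (simp add: dvd_imp_le)
qed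

text \<open>The weight \<open>(p / (p - 1)) ^ 8 / p\<close> is at least 1 for 2, 3, 5 and at most 1
  from 7 on, so the prime set \<open>{2, 3, 5}\<close> is extremal; there the ratio is
  \<open>15/4\<close> and the product of the primes is 30.\<close>

lemma totient_ratio_power8_le:
  assumes "k > 0"
  shows "totient_ratio k ^ 8 \<le> (15/4) ^ 8 / 30 * real k"
proof -
  define f :: "nat \<Rightarrow> real" where "f = (\<lambda>p. (real p / (real p - 1)) ^ 8 / real p)"
  let ?P = "prime_factors k" and ?A = "{2, 3, 5} :: nat set"
  have f_le: "f p \<le> 1" if "p \<in> ?P" "p \<notin> ?A" for p
  proof -
    have "prime p" using that by (auto simp: in_prime_factors_iff)
    moreover have "\<not> prime (4::nat)" "\<not> prime (6::nat)" by simp_all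
    ultimately have "p \<noteq> 0" "p \<noteq> 1" "p \<noteq> 4" "p \<noteq> 6"
      by (auto intro: ccontr)
    with that have "p \<ge> 7" by auto
    then have "real p / (real p - 1) \<le> 7 / 6" by (simp add: field_simps)
    then have "(real p / (real p - 1)) ^ 8 \<le> (7 / 6) ^ 8" using \<open>p \<ge> 7\<close>
      by (intro power_mono) auto
    also have "\<dots> \<le> real p" using \<open>p \<ge> 7\<close> by (simp add: power_divide)
    finally show ?thesis using \<open>p \<ge> 7\<close> by (simp add: f_def)
  qed
  have f_ge: "f p \<ge> 1" if "p \<in> ?A" for p using that by (auto simp: f_def power_divide)
  have f_nonneg: "f p \<ge> 0" for p by (simp add: f_def)
  have "prod f ?P = prod f (?P \<inter> ?A) * prod f (?P - ?A)"
    by (metis prod.Int_Diff finite_set_mset)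
  also have "\<dots> \<le> prod f (?P \<inter> ?A) * 1"
    using f_le f_nonneg by (intro mult_left_mono prod_le_1 prod_nonneg) auto
  also have "\<dots> \<le> prod f ?A"
    unfolding mult_1_right
  proof (rule prod_mono2)
    show "1 \<le> f p" if "p \<in> ?A - ?P \<inter> ?A" for p using that f_ge by blast
  qed (use f_nonneg in auto)
  also have "\<dots> = (15/4) ^ 8 / 30" by (simp add: f_def power_divide)
  finally have 1: "prod f ?P \<le> (15/4) ^ 8 / 30" .
  have 2: "\<Prod>?P \<le> k" using assms by (rule prod_prime_factors_le)
  have "totient_ratio k ^ 8 = prod f ?P * real (\<Prod>?P)"
    unfolding totient_ratio_def f_def of_nat_prod prod_power_distrib prod.distrib[symmetric]
    by (intro prod.cong refl) (auto dest!: prime_factor_gt_1)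
  also have "\<dots> \<le> (15/4) ^ 8 / 30 * real k"
    using 1 2 by (intro mult_mono) (auto simp del: of_nat_prod)
  finally show ?thesis .
qed

text \<open>The \<open>i\<close>-th smallest element of \<open>P\<close> is at least
  \<open>i + 1\<close>, so both products compare with those over consecutive integers from 2 on, the
  first of which telescopes. The induction removes the maximum.\<close>

lemma prod_ratio_le_card:
  fixes P :: "nat set"
  assumes "finite P" "\<And>p. p \<in> P \<Longrightarrow> p \<ge> 2"
  shows "(\<Prod>p\<in>P. real p / (real p - 1)) \<le> real (card P) + 1 \<and> fact (card P + 1) \<le> \<Prod>P"
  using assms
proof (induction "card P" arbitrary: P)
  case (Suc n)
  then have "P \<noteq> {}" by auto
  define M where "M = Max P"
  have M: "M \<in> P" using Suc \<open>P \<noteq> {}\<close> by (simp add: M_def)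
  have "P \<subseteq> {2..M}" using Suc by (auto simp: M_def)
  then have nM: "n + 2 \<le> M" using card_mono[of "{2..M}" P] Suc(2) by simp
  have "card (P - {M}) = n" using Suc(2,3) M by simp
  then have IH: "(\<Prod>p\<in>P - {M}. real p / (real p - 1)) \<le> real n + 1" "fact (n + 1) \<le> \<Prod>(P - {M})"
    using Suc(1)[of "P - {M}"] Suc(3,4) by auto
  have "(\<Prod>p\<in>P. real p / (real p - 1)) = real M / (real M - 1) * (\<Prod>p\<in>P - {M}. real p / (real p - 1))"
    using Suc M by (intro prod.remove) auto
  also have "\<dots> \<le> (real n + 2) / (real n + 1) * (real n + 1)"
    using IH(1) nM Suc(4) by (intro mult_mono prod_nonneg) (force simp: field_simps)+
  also have "\<dots> = real (card P) + 1" using Suc(2)[symmetric] by simp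
  finally have "(\<Prod>p\<in>P. real p / (real p - 1)) \<le> real (card P) + 1" .
  moreover have "fact (card P + 1) = (n + 2) * fact (n + 1)" using Suc(2)[symmetric] by simp
  moreover have "\<dots> \<le> M * \<Prod>(P - {M})" using nM IH(2) by (intro mult_mono) auto
  moreover have "\<dots> = \<Prod>P" using Suc M by (intro prod.remove[symmetric]) auto
  ultimately show ?case by simp
qed auto

lemma totient_ratio_le_of_less_fact:
  assumes "k > 0" "k < fact (j + 1)"
  shows "totient_ratio k \<le> real j"
proof -
  let ?P = "prime_factors k"
  have P: "totient_ratio k \<le> real (card ?P) + 1" "fact (card ?P + 1) \<le> \<Prod>?P"
    using prod_ratio_le_card[of ?P] prime_factor_gt_1[of _ k]
    by (auto simp: totient_ratio_def Suc_le_eq numeral_2_eq_2)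
  have "fact (card ?P + 1) < (fact (j + 1) :: nat)"
    using P(2) prod_prime_factors_le[OF assms(1)] assms(2) by linarith
  then have "card ?P + 1 < j + 1"
    by (meson fact_mono_nat linorder_not_less)
  then show ?thesis using P(1) by simp
qed

section \<open>Estimates for harmonic sums\<close>

lemma sum_inverse_le_harm:
  fixes J :: "nat set"
  assumes "finite J" "0 \<notin> J"
  shows "(\<Sum>j\<in>J. 1 / real j) \<le> harm (card J)"
  using assms
proof (induction "card J" arbitrary: J)
  case (Suc n)
  then have "J \<noteq> {}" by auto
  define M where "M = Max J"
  have M: "M \<in> J" using Suc \<open>J \<noteq> {}\<close> by (simp add: M_def)
  have "J \<subseteq> {1..M}" using Suc by (auto simp: M_def Suc_le_eq intro: ccontr)
  then have "Suc n \<le> M" using card_mono[of "{1..M}" J] Suc by simp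
  have "(\<Sum>j\<in>J. 1 / real j) = 1 / real M + (\<Sum>j\<in>J - {M}. 1 / real j)"
    using Suc M by (intro sum.remove) auto
  also have "\<dots> \<le> 1 / real (Suc n) + harm n"
  proof (rule add_mono)
    have "card (J - {M}) = n" using Suc(2-4) M by simp
    then show "(\<Sum>j\<in>J - {M}. 1 / real j) \<le> harm n" using Suc(1)[of "J - {M}"] Suc(3,4) by simp
  qed (use \<open>Suc n \<le> M\<close> in \<open>auto simp: frac_le\<close>)
  also have "\<dots> = harm (card J)" using Suc(2)[symmetric]
    by (simp add: harm_Suc inverse_eq_divide)
  finally show ?case .
qed (auto simp: harm_def)

lemma harm_le_ln:
  assumes "n > 0"
  shows "harm n \<le> 1 + ln (real n)"
proof -
  obtain m where m: "n = Suc m" using assms by (cases n) auto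
  have "harm (Suc m) - ln (real (Suc m)) \<le> harm (Suc 0) - ln (real (Suc 0))"
    using decseq_harm_diff_ln by (rule decseqD) simp
  then show ?thesis using m by (simp add: harm_expand)
qed

text \<open>Here \<open>29/20\<close> is an upper bound for \<open>1 / ln 2\<close>. The exponential
  is replaced by its Taylor polynomial of degree 4, which reduces the claim to the positivity of a
  quartic.\<close>

lemma quadratic_le_exp:
  fixes t :: real
  assumes "t \<ge> 0"
  shows "(1 + 29/20 * t) * (1 + t) \<le> 19/10 * exp t"
proof -
  obtain u where u: "exp t = (\<Sum>m<5. t ^ m / fact m) + exp u / fact 5 * t ^ 5"
    using Maclaurin_exp_le[of t 5] by auto
  then have "exp t \<ge> (\<Sum>m<5. t ^ m / fact m)" using assms by simp
  then have e: "exp t \<ge> 1 + t + t^2 / 2 + t^3 / 6 + t^4 / 24"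
    by (simp add: eval_nat_numeral fact_numeral)
  \<comment> \<open>The cubic part of that quartic has its local minimum near \<open>29/20\<close>.
    Splitting off this square matches its top two coefficients and leaves a small linear remainder,
    which the term in \<open>t ^ 4\<close> absorbs.\<close>
  have "0 \<le> 19/60 * (t - 29/20)\<^sup>2 * (t + 251/190)" using assms by simp
  moreover have "0 \<le> 1/100 - 3/1000 * t + 19/240 * t ^ 4"
  proof (cases "t \<le> 1")
    case False
    then have "t ^ 1 \<le> t ^ 4" by (intro power_increasing) auto
    then show ?thesis using False by simp
  qed (use assms in \<open>auto intro: add_nonneg_nonneg\<close>)
  moreover have "9/10 - 11/20 * t - 1/2 * t^2 + 19/60 * t^3 + 19/240 * t ^ 4
      = 19/60 * (t - 29/20)\<^sup>2 * (t + 251/190) + (4909/240000 - 21/8000 * t) + 19/240 * t ^ 4"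
    by (simp add: power2_eq_square power3_eq_cube field_simps)
  ultimately have "0 \<le> 9/10 - 11/20 * t - 1/2 * t^2 + 19/60 * t^3 + 19/240 * t ^ 4"
    using assms by linarith
  moreover have "(1 + 29/20 * t) * (1 + t) = 1 + 49/20 * t + 29/20 * t^2"
    by (simp add: field_simps power2_eq_square)
  ultimately show ?thesis using e by linarith
qed

text \<open>
  The constant \<open>19/20\<close> is half of the \<open>19/10\<close> above: with \<open>t = ln (\<kappa> Min Q)\<close> the number of
  classes is at most \<open>1 + t / ln 2\<close> and each contributes at most \<open>(1 + t) / (2 Min Q)\<close>.
\<close>

lemma sum_harm_le:
  fixes Q :: "nat set" and N :: "nat \<Rightarrow> nat" and \<kappa> :: real
  assumes Q: "finite Q" "Q \<noteq> {}" "0 \<notin> Q"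
    and N: "\<And>q. q \<in> Q \<Longrightarrow> N q \<ge> 1" "\<And>q. q \<in> Q \<Longrightarrow> real (N q) \<le> \<kappa> * real q"
    and card: "2 ^ (card Q - 1) \<le> N (Min Q)"
  shows "(\<Sum>q\<in>Q. harm (N q) / (2 * real q)) \<le> 19/20 * \<kappa>"
proof -
  define q where "q = Min Q"
  have q: "q \<in> Q" using Q by (simp add: q_def)
  then have "q > 0" using Q(3) by (intro gr0I) auto
  define K where "K = \<kappa> * real q"
  have K: "real (N q) \<le> K" "K \<ge> 1" using N[OF q] by (auto simp: K_def)
  define t where "t = ln K"
  have t: "t \<ge> 0" "exp t = K" using K by (auto simp: t_def)
  have "(2::real) ^ (card Q - 1) \<le> K"
    using of_nat_mono[OF card, where 'a = real] K(1)
    unfolding q_def of_nat_power of_nat_numeral by linarith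
  then have "ln ((2::real) ^ (card Q - 1)) \<le> t" unfolding t_def using K by simp
  moreover have "card Q \<ge> 1" using Q by (simp add: Suc_le_eq card_gt_0_iff)
  ultimately have "(real (card Q) - 1) * ln 2 \<le> t" by (simp add: ln_realpow of_nat_diff)
  moreover have "(real (card Q) - 1) * (20/29) \<le> (real (card Q) - 1) * ln 2"
    using \<open>card Q \<ge> 1\<close> ln_approx_bounds[of 2 3] by (intro mult_left_mono) (auto simp: eval_nat_numeral)
  ultimately have r: "real (card Q) \<le> 1 + 29/20 * t" by simp
  \<comment> \<open>Passing from the minimum \<open>q\<close> to \<open>p\<close> raises the
    logarithm by only \<open>ln (p / q) <= p / q - 1\<close>, which the division by \<open>p\<close>
    compensates; every term is thus bounded by the value at the minimum.\<close>
  have each: "harm (N p) / (2 * real p) \<le> (1 + t) / (2 * real q)" if p: "p \<in> Q" for p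
  proof -
    have "p \<ge> q" using p Q by (simp add: q_def)
    have Np: "N p > 0" using N(1)[OF p] by simp
    have "harm (N p) \<le> 1 + ln (real (N p))" using Np by (rule harm_le_ln)
    also have "ln (real (N p)) \<le> ln (K * (real p / real q))"
      using N(2)[OF p] Np \<open>q > 0\<close> by (simp add: K_def)
    also have "\<dots> = t + ln (real p / real q)"
      using K \<open>q > 0\<close> \<open>p \<ge> q\<close> by (subst ln_mult) (auto simp: t_def)
    also have "ln (real p / real q) \<le> real p / real q - 1"
      using \<open>q > 0\<close> \<open>p \<ge> q\<close> by (intro ln_le_minus_one) auto
    finally have "harm (N p) \<le> t + real p / real q" by simp
    also have "t \<le> t * (real p / real q)"
      using t(1) \<open>q > 0\<close> \<open>p \<ge> q\<close> by (simp add: field_simps mult_left_mono)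
    finally show ?thesis using \<open>q > 0\<close> \<open>p \<ge> q\<close> by (simp add: field_simps)
  qed
  have "(\<Sum>q\<in>Q. harm (N q) / (2 * real q)) \<le> real (card Q) * ((1 + t) / (2 * real q))"
    using each by (rule sum_bounded_above)
  also have "\<dots> \<le> (1 + 29/20 * t) * ((1 + t) / (2 * real q))"
    using r t by (intro mult_right_mono) auto
  also have "\<dots> = (1 + 29/20 * t) * (1 + t) / (2 * real q)" by simp
  also have "\<dots> \<le> 19/10 * K / (2 * real q)"
    using quadratic_le_exp[OF t(1)] t(2) by (intro divide_right_mono) auto
  also have "\<dots> = 19/20 * \<kappa>" using \<open>q > 0\<close> by (simp add: K_def)
  finally show ?thesis .
qed

section \<open>Size and valuation of the quotients\<close>

lemma quotient_add_cong:
  fixes a b m A p :: nat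
  assumes "odd m" "A * (a + b) = a ^ m + b ^ m" "p dvd a + b" "a > 0"
  shows "[A = m * a ^ (m - 1)] (mod p)"
proof -
  have "int a ^ m - (- int b) ^ m = (int a - (- int b)) * int A"
    using assms(1,2) by (simp add: mult.commute flip: of_nat_add of_nat_mult of_nat_power)
  then have "[int A = int m * int a ^ (m - 1)] (mod int p)"
    using assms by (intro power_diff_quotient_cong[where t = "- int b"]) (auto simp flip: of_nat_add)
  then show ?thesis by (metis cong_int_iff of_nat_mult of_nat_power)
qed

lemma quotient_diff_cong:
  fixes a b n B p :: nat
  assumes "even n" "B * (a + b) + b ^ n = a ^ n" "p dvd a + b" "a > 0"
  shows "[B = n * a ^ (n - 1)] (mod p)"
proof -
  have "int a ^ n - int b ^ n = (int a + int b) * int B"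
    using arg_cong[OF assms(2), of int] by (simp add: algebra_simps)
  then have "int a ^ n - (- int b) ^ n = (int a - (- int b)) * int B"
    using assms(1) by simp
  then have "[int B = int n * int a ^ (n - 1)] (mod int p)"
    using assms by (intro power_diff_quotient_cong[where t = "- int b"]) (auto simp flip: of_nat_add)
  then show ?thesis by (metis cong_int_iff of_nat_mult of_nat_power)
qed

text \<open>Cancelling \<open>z\<close>, the ratio equals
  \<open>A / B = (x ^ m + y ^ m) / (x ^ n - y ^ n)\<close>, which exceeds
  \<open>x ^ (m - n)\<close>.\<close>

lemma totient_ratio_gt:
  fixes x y z m n A B :: nat
  assumes "y > 0" "x > 0" "z > 0" "n < m"
    and A: "A * (x + y) = x ^ m + y ^ m" and B: "B * (x + y) + y ^ n = x ^ n"
    and tot: "totient (z * A) = z * B"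
  shows "real x < totient_ratio (z * A)"
proof -
  let ?r = "totient_ratio (z * A)"
  have "real z * real A = ?r * (real z * real B)"
    using totient_ratio_eq[of "z * A"] tot by simp
  then have "real A = ?r * real B" using assms(3) by simp
  then have "real A * (real x + real y) = ?r * (real B * (real x + real y))" by simp
  moreover have "real A * (real x + real y) = real x ^ m + real y ^ m"
    using arg_cong[OF A, of real] by simp
  moreover have "real B * (real x + real y) = real x ^ n - real y ^ n"
    using arg_cong[OF B, of real] by simp
  ultimately have eq: "real x ^ m + real y ^ m = ?r * (real x ^ n - real y ^ n)" by simp
  have "?r \<ge> 1" unfolding totient_ratio_def
    by (intro prod_ratio_ge_1) (rule prime_factor_gt_1)
  have "real x * real x ^ n = real x ^ Suc n" by simp
  also have "\<dots> \<le> real x ^ m" using assms by (intro power_increasing) auto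
  also have "\<dots> < real x ^ m + real y ^ m" using assms by simp
  also have "\<dots> \<le> ?r * real x ^ n"
    unfolding eq using \<open>?r \<ge> 1\<close> by (intro mult_left_mono) auto
  finally show ?thesis using assms(2) by simp
qed

lemma totient_ratio_gt_scaled:
  fixes a b g z m n A B :: nat
  assumes "a > 0" "b > 0" "g > 0" "z > 0" "n > 0" "n < m"
    and A: "A * (a + b) = a ^ m + b ^ m" and B: "B * (a + b) + b ^ n = a ^ n"
    and tot: "totient (z * (g ^ (m - 1) * A)) = z * (g ^ (n - 1) * B)"
  shows "real (g * a) < totient_ratio (z * (g ^ (m - 1) * A))"
proof (rule totient_ratio_gt[OF _ _ assms(4,6) _ _ tot])
  have pow: "g ^ m = g * g ^ (m - 1)" "g ^ n = g * g ^ (n - 1)"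
    using assms by (simp_all flip: power_Suc)
  show "g * b > 0" "g * a > 0" using assms by auto
  have "g ^ (m - 1) * A * (g * a + g * b) = g * g ^ (m - 1) * (A * (a + b))"
    by (simp add: algebra_simps)
  then show "g ^ (m - 1) * A * (g * a + g * b) = (g * a) ^ m + (g * b) ^ m"
    unfolding A pow(1)[symmetric] by (simp add: power_mult_distrib algebra_simps)
  have "g ^ (n - 1) * B * (g * a + g * b) + (g * b) ^ n
      = g * g ^ (n - 1) * (B * (a + b)) + g ^ n * b ^ n"
    by (simp add: algebra_simps power_mult_distrib)
  also have "\<dots> = g ^ n * (B * (a + b) + b ^ n)"
    unfolding pow(2)[symmetric] by (simp add: algebra_simps)
  finally show "g ^ (n - 1) * B * (g * a + g * b) + (g * b) ^ n = (g * a) ^ n"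
    unfolding B by (simp add: power_mult_distrib)
qed

text \<open>Apply \<open>multiplicity_totient_ge\<close> to the equation: the valuation of
  \<open>z\<close> occurs on both sides, and as \<open>n < m\<close> the power of \<open>g\<close>
  on the left outweighs the one on the right, so only \<open>A\<close> and \<open>B\<close>
  remain.\<close>

lemma multiplicity_quotients:
  fixes q z g m n A B :: nat
  assumes "prime q" "z > 0" "g > 0" "n < m" "A > 0" "B > 0"
    and tot: "totient (z * (g ^ (m - 1) * A)) = z * (g ^ (n - 1) * B)"
  shows "card {p \<in> prime_factors (z * (g ^ (m - 1) * A)). q dvd p - 1} + multiplicity q A
    \<le> 1 + multiplicity q B"
proof -
  have "multiplicity q (z * (g ^ (m - 1) * A)) = multiplicity q z + (m - 1) * multiplicity q g + multiplicity q A"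
    "multiplicity q (z * (g ^ (n - 1) * B)) = multiplicity q z + (n - 1) * multiplicity q g + multiplicity q B"
    using assms by (simp_all add: prime_elem_multiplicity_mult_distrib prime_elem_multiplicity_power_distrib)
  moreover have "(n - 1) * multiplicity q g \<le> (m - 1) * multiplicity q g"
    using assms(4) by (intro mult_right_mono) auto
  moreover have "z * (g ^ (m - 1) * A) > 0" using assms by simp
  note multiplicity_totient_ge[OF assms(1) this]
  ultimately show ?thesis unfolding tot by linarith
qed

section \<open>Logarithmic bounds on the number of primes in a residue class\<close>

lemma ln_lower_bounds:
  "ln (2::real) \<ge> 69/100" "ln (3::real) \<ge> 109/100" "ln (5::real) \<ge> 8/5" "ln (7::real) \<ge> 193/100"
  using ln_approx_bounds[of 2 3] ln_approx_bounds[of 3 3] ln_approx_bounds[of 5 5] ln_approx_bounds[of 7 6]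
  by (simp_all add: eval_nat_numeral)

text \<open>
  The case \<open>a = 5\<close> needs the sharper constant: there \<open>z = 6\<close> already contributes a factor \<open>3\<close>, leaving
  only \<open>A / \<phi>(A) > 5/3\<close>.
\<close>

lemma class_size_le:
  fixes a q h N :: nat
  assumes "a \<ge> 3" "q = 2 * h + 1" "N \<ge> 1" "prime q"
    and gen: "q ^ (N - 1) < a ^ h" and three: "q = 3 \<Longrightarrow> 2 * 3 ^ (N - 1) < a"
  shows "real N \<le> 19/50 * ln (real a) * real q"
    and "a = 5 \<Longrightarrow> real N \<le> 8/25 * ln (real a) * real q"
proof -
  define L where "L = ln (real a)"
  have "ln 3 \<le> L" unfolding L_def using assms(1) by (subst ln_le_cancel_iff) auto
  then have L: "L \<ge> 109/100" using ln_lower_bounds(2) by linarith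
  have "ln 5 \<le> L" if "a \<ge> 5" unfolding L_def using that by (subst ln_le_cancel_iff) auto
  then have L5: "L \<ge> 8/5" if "a \<ge> 5" using ln_lower_bounds(3) that by force
  obtain M where M: "N = Suc M" using assms(3) by (cases N) auto
  have "real (q ^ M) \<le> real (a ^ h)" using gen M by (subst of_nat_le_iff) simp
  moreover have "q > 1" using assms(4) prime_gt_1_nat by auto
  ultimately have "ln (real q ^ M) \<le> ln (real a ^ h)" using assms(1)
    by (subst ln_le_cancel_iff) auto
  then have *: "real M * ln (real q) \<le> real h * L"
    using \<open>q > 1\<close> assms(1) by (simp add: ln_realpow L_def)
  have "real N \<le> 19/50 * L * real q \<and> (a = 5 \<longrightarrow> real N \<le> 8/25 * L * real q)"
  proof -
    have "q = 3 \<or> q = 5 \<or> q \<ge> 7" using \<open>q > 1\<close> assms(2) by presburger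
    then consider "q = 3" | "q = 5" | "q \<ge> 7" by blast
    then show ?thesis
    proof cases
      case 1
      show ?thesis
      proof (cases "a \<le> 5")
        case True
        \<comment> \<open>At \<open>a = 5\<close> the hypothesis \<open>gen\<close> would still
          admit \<open>N = 2\<close>, which exceeds both claimed bounds; \<open>three\<close>
          excludes it.\<close>
        then have "3 ^ M < (3::nat)" using three[OF 1] M by simp
        then have "M = 0" by (cases M) auto
        then show ?thesis using L 1 M by simp
      next
        case False
        have "real (2 * 3 ^ M) \<le> real a" using three[OF 1] M by (subst of_nat_le_iff) simp
        then have "ln (2 * 3 ^ M) \<le> L" unfolding L_def using assms(1) by (subst ln_le_cancel_iff) auto
        then have "ln 2 + real M * ln 3 \<le> L" by (simp add: ln_mult ln_realpow)
        moreover have "real M * (109/100) \<le> real M * ln 3"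
          using ln_lower_bounds(2) by (intro mult_left_mono) auto
        moreover have "ln (2 * 3) \<le> L" unfolding L_def using False by (subst ln_le_cancel_iff) auto
        then have "ln 2 + ln 3 \<le> L" by (subst (asm) ln_mult) auto
        ultimately have "69/100 + real M * (109/100) \<le> L" "178/100 \<le> L"
          using ln_lower_bounds by linarith+
        then show ?thesis using 1 M False by simp
      qed
    next
      case 2
      then have h: "h = 2" using assms(2) by simp
      have M2: "M \<le> 1" if "a \<le> 5"
      proof (rule ccontr)
        assume "\<not> M \<le> 1"
        then have "5 ^ 2 \<le> (5::nat) ^ M" by (intro power_increasing) auto
        moreover have "a ^ 2 \<le> 5 ^ 2" using that by (intro power_mono) auto
        ultimately show False using gen 2 h M by simp
      qed
      have "real M * (8/5) \<le> real M * ln 5" using ln_lower_bounds(3) by (intro mult_left_mono) auto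
      then have "real M * (8/5) \<le> 2 * L" using * 2 h by simp
      then show ?thesis
        using M2 L L5 2 M by (cases "a \<ge> 5"; cases "a = 5") auto
    next
      case 3
      define w where "w = L * real q"
      have "7 * L \<le> w" unfolding w_def using L 3 by simp
      have "ln 7 \<le> ln (real q)" using 3 by (subst ln_le_cancel_iff) auto
      then have "real M * (193/100) \<le> real M * ln (real q)"
        using ln_lower_bounds(4) by (intro mult_left_mono) auto
      also note *
      also have "real h * L = (w - L) / 2" unfolding w_def assms(2) by (simp add: algebra_simps)
      finally have "real M * (193/100) \<le> (w - L) / 2" .
      then have "real N \<le> 19/50 * w \<and> (a = 5 \<longrightarrow> real N \<le> 8/25 * w)"
        using \<open>7 * L \<le> w\<close> L L5 M by auto
      then show ?thesis by (simp add: w_def mult.assoc)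
    qed
  qed
  then show "real N \<le> 19/50 * ln (real a) * real q"
    and "a = 5 \<Longrightarrow> real N \<le> 8/25 * ln (real a) * real q" by (auto simp: L_def)
qed

section \<open>Odd coprime bases and coprime exponents\<close>

context
  fixes a b g z m n A B :: nat
  assumes ab: "coprime a b" "odd a" "odd b" "b < a"
    and mn: "coprime m n" "odd m" "even n" "n > 0" "n < m"
    and A: "A * (a + b) = a ^ m + b ^ m" and B: "B * (a + b) + b ^ n = a ^ n"
    and gz: "g > 0" "z > 0" "z \<le> g * (a + b)"
    and tot: "totient (z * (g ^ (m - 1) * A)) = z * (g ^ (n - 1) * B)"
begin

definition class_size :: "nat \<Rightarrow> nat" where
  "class_size q = card {p \<in> prime_factors A. q dvd p - 1}"

lemma quotient_basics:
  shows "a \<ge> 3" "a > 0" "b > 0" "b + 2 \<le> a" "A > 0" "B > 0" "odd A"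
proof -
  show b: "b > 0" using ab(3) by (rule odd_pos)
  have "b + 1 \<noteq> a" using ab by auto
  then show "b + 2 \<le> a" using ab by simp
  then show "a \<ge> 3" "a > 0" using b by auto
  show "A > 0" using A \<open>a > 0\<close> by (intro gr0I) auto
  have "b ^ n < a ^ n" using ab(4) mn(4) by (intro power_strict_mono) auto
  then show "B > 0" using B by (intro gr0I) auto
  have "[A = m * a ^ (m - 1)] (mod 2)"
    using ab \<open>a > 0\<close> by (intro quotient_add_cong[OF mn(2) A]) auto
  then have "even A \<longleftrightarrow> even (m * a ^ (m - 1))" by (rule cong_dvd_iff)
  then show "odd A" using mn ab by simp
qed

lemma class_size_multiplicity:
  assumes "prime q"
  shows "class_size q + multiplicity q A \<le> 1 + multiplicity q B"
proof -
  have "class_size q \<le> card {p \<in> prime_factors (z * (g ^ (m - 1) * A)). q dvd p - 1}"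
    unfolding class_size_def using gz quotient_basics
    by (intro card_mono) (auto simp: in_prime_factors_iff)
  then show ?thesis
    using multiplicity_quotients[OF assms gz(2,1) mn(5) quotient_basics(5,6) tot] by linarith
qed

lemma exponent_prime_factor:
  assumes "q \<in> prime_factors m"
  shows "prime q" "odd q" "q dvd m" "\<not> q dvd n"
proof -
  show q: "prime q" "q dvd m" using assms by (auto simp: in_prime_factors_iff)
  show "odd q" using q mn(2) by (meson dvd_trans)
  show "\<not> q dvd n" using q mn(1) by (metis coprime_common_divisor not_prime_unit)
qed

text \<open>Each of the \<open>2 ^ (r - 1)\<close> sets of prime factors of \<open>m\<close>
  containing \<open>q\<close>, with \<open>r\<close> their total number, gives a prime whose order
  is the product of the set. It divides \<open>A\<close>, is 1 modulo \<open>q\<close>, and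
  determines the set.\<close>

lemma class_size_ge:
  assumes q: "q \<in> prime_factors m"
  shows "2 ^ (card (prime_factors m) - 1) \<le> class_size q"
proof -
  let ?Q = "prime_factors m"
  have "\<exists>p. prime p \<and> \<Prod>S dvd p - 1 \<and> (\<forall>k. odd k \<longrightarrow> (p dvd a ^ k + b ^ k \<longleftrightarrow> \<Prod>S dvd k))"
    if "S \<subseteq> ?Q" "S \<noteq> {}" for S
  proof -
    have "finite S" by (rule finite_subset[OF that(1) finite_set_mset])
    moreover have "prime s" "odd s" if "s \<in> S" for s
      using exponent_prime_factor[of s] that \<open>S \<subseteq> ?Q\<close> by auto
    ultimately show ?thesis
      using prime_of_order_prod[of a b S] that ab quotient_basics by metis
  qed
  then obtain P where P: "\<And>S. S \<subseteq> ?Q \<Longrightarrow> S \<noteq> {} \<Longrightarrow>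
      prime (P S) \<and> \<Prod>S dvd P S - 1 \<and> (\<forall>k. odd k \<longrightarrow> (P S dvd a ^ k + b ^ k \<longleftrightarrow> \<Prod>S dvd k))"
    by metis
  have odd_prod: "odd (\<Prod>S)" if "S \<subseteq> ?Q" for S
    using exponent_prime_factor that by (intro odd_prod_odd_set) auto
  have dvd_m: "\<Prod>S dvd m" if "S \<subseteq> ?Q" for S
    using exponent_prime_factor that finite_subset[OF that] by (intro prod_primes_dvd) auto
  let ?f = "\<lambda>T. P (insert q T)"
  have sub: "insert q T \<subseteq> ?Q" if "T \<in> Pow (?Q - {q})" for T using that q by auto
  have "card (Pow (?Q - {q})) \<le> card {p \<in> prime_factors A. q dvd p - 1}"
  proof (rule card_inj_on_le[of ?f])
    show "inj_on ?f (Pow (?Q - {q}))"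
    proof (rule inj_onI)
      fix S T assume ST: "S \<in> Pow (?Q - {q})" "T \<in> Pow (?Q - {q})" "?f S = ?f T"
      have d: "\<Prod>(insert q S) dvd k \<longleftrightarrow> \<Prod>(insert q T) dvd k" if "odd k" for k
        using P[OF sub[OF ST(1)]] P[OF sub[OF ST(2)]] ST(3) that by auto
      have eq: "\<Prod>(insert q S) = \<Prod>(insert q T)"
      proof (rule dvd_antisym)
        show "\<Prod>(insert q S) dvd \<Prod>(insert q T)"
          by (rule iffD2[OF d[OF odd_prod[OF sub[OF ST(2)]]] dvd_refl])
        show "\<Prod>(insert q T) dvd \<Prod>(insert q S)"
          by (rule iffD1[OF d[OF odd_prod[OF sub[OF ST(1)]]] dvd_refl])
      qed
      have fin: "finite (insert q S)" "finite (insert q T)"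
        by (rule finite_subset[OF sub finite_set_mset], rule ST)+
      have "prime s" if "s \<in> insert q S \<union> insert q T" for s
        using that sub[OF ST(1)] sub[OF ST(2)] exponent_prime_factor(1)[of s] by blast
      then have "insert q S = insert q T" using prod_primes_inject[OF fin _ eq] by blast
      then show "S = T" using ST by blast
    qed
    show "?f ` Pow (?Q - {q}) \<subseteq> {p \<in> prime_factors A. q dvd p - 1}"
    proof (rule image_subsetI)
      fix T assume "T \<in> Pow (?Q - {q})"
      note T = sub[OF this]
      define p where "p = ?f T"
      have p: "prime p" "\<Prod>(insert q T) dvd p - 1"
        "\<And>k. odd k \<Longrightarrow> p dvd a ^ k + b ^ k \<longleftrightarrow> \<Prod>(insert q T) dvd k"
        using P[OF T] by (auto simp: p_def)
      have "finite (insert q T)" by (rule finite_subset[OF T finite_set_mset])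
      then have qd: "q dvd \<Prod>(insert q T)" by (rule dvd_prodI) simp
      have "p dvd A * (a + b)" unfolding A using p(3)[OF mn(2)] dvd_m[OF T] by simp
      moreover have "\<not> p dvd a + b"
      proof
        assume "p dvd a + b"
        then have "\<Prod>(insert q T) dvd 1" using p(3)[of 1] by simp
        then have "q dvd 1" using qd dvd_trans by blast
        then show False using exponent_prime_factor(1)[OF q] by auto
      qed
      ultimately have "p dvd A" using p(1) prime_dvd_mult_iff by blast
      then show "?f T \<in> {p \<in> prime_factors A. q dvd p - 1}"
        using p qd quotient_basics by (auto simp: p_def[symmetric] in_prime_factors_iff intro: dvd_trans)
    qed
  qed auto
  then show ?thesis unfolding class_size_def using q by (simp add: card_Pow)
qed

lemma class_size_pos: "q \<in> prime_factors m \<Longrightarrow> class_size q \<ge> 1"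
  using class_size_ge[of q] by (metis le_trans one_le_numeral one_le_power)

text \<open>If \<open>q\<close> divided \<open>a + b\<close>, the congruences for the quotients
  would make \<open>q\<close> divide \<open>A\<close> but not \<open>B\<close>. As the class of
  \<open>q\<close> is nonempty, this violates \<open>class_size_multiplicity\<close>.\<close>

lemma prime_factor_not_dvd_base_sum:
  assumes q: "q \<in> prime_factors m"
  shows "\<not> q dvd a + b"
proof
  assume d: "q dvd a + b"
  note q' = exponent_prime_factor[OF q]
  have "\<not> q dvd a" using prime_dvd_power_add_coprime[OF q'(1), of a 1 b] d ab by simp
  have "[A = m * a ^ (m - 1)] (mod q)" using quotient_basics d by (intro quotient_add_cong[OF mn(2) A])
  then have "q dvd A" using q'(3) cong_dvd_iff dvd_mult2 by blast
  then have "multiplicity q A \<ge> 1" using quotient_basics q'(1) by (intro multiplicity_geI) auto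
  moreover have "[B = n * a ^ (n - 1)] (mod q)" using quotient_basics d by (intro quotient_diff_cong[OF mn(3) B])
  then have "\<not> q dvd B" using q'(1,4) \<open>\<not> q dvd a\<close> cong_dvd_iff prime_dvd_mult_iff prime_dvd_power by metis
  then have "multiplicity q B = 0" by (rule not_dvd_imp_multiplicity_0)
  ultimately show False
    using class_size_multiplicity[OF q'(1)] class_size_pos[OF q] by linarith
qed

text \<open>The order of \<open>-a/b\<close> modulo \<open>p\<close> divides \<open>m\<close> and
  \<open>p - 1\<close>, so any prime factor of it serves as \<open>q\<close>. Order 1 would force
  \<open>p\<close> to divide both \<open>a + b\<close> and \<open>m\<close>, which was just
  excluded.\<close>

lemma prime_factor_class:
  assumes p: "p \<in> prime_factors A"
  obtains q where "q \<in> prime_factors m" "q dvd p - 1"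
proof -
  have pp: "prime p" "p dvd A" using p by (auto simp: in_prime_factors_iff)
  have pd: "p dvd a ^ m + b ^ m" using pp(2) unfolding A[symmetric] by simp
  have "m > 0" using mn by simp
  then have nab: "\<not> p dvd a" "\<not> p dvd b"
    using prime_dvd_power_add_coprime[OF pp(1) pd ab(1)] by auto
  then obtain o' where o': "o' dvd p - 1" "\<And>k. odd k \<Longrightarrow> p dvd a ^ k + b ^ k \<longleftrightarrow> o' dvd k"
    using odd_power_add_order[OF pp(1)] by blast
  have om: "o' dvd m" using o'(2)[OF mn(2)] pd by simp
  have "o' \<noteq> 1"
  proof
    assume "o' = 1"
    then have d: "p dvd a + b" using o'(2)[of 1] by simp
    have "[A = m * a ^ (m - 1)] (mod p)" using quotient_basics d by (intro quotient_add_cong[OF mn(2) A])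
    then have "p dvd m * a ^ (m - 1)" using pp(2) cong_dvd_iff by blast
    then have "p dvd m" using pp(1) nab prime_dvd_mult_iff prime_dvd_power by blast
    then have "p \<in> prime_factors m" using pp(1) \<open>m > 0\<close> by (auto simp: in_prime_factors_iff)
    then show False using prime_factor_not_dvd_base_sum d by blast
  qed
  then obtain q where "prime q" "q dvd o'" using prime_factor_nat by blast
  then show ?thesis using that[of q] o'(1) om \<open>m > 0\<close>
    by (auto simp: in_prime_factors_iff intro: dvd_trans)
qed

text \<open>As \<open>q\<close> does not divide \<open>n\<close>, the power of \<open>q\<close> in
  \<open>B\<close> already divides \<open>a ^ (q - 1) - b ^ (q - 1)\<close>, where \<open>n\<close>
  has disappeared. This factors as \<open>(a ^ h + b ^ h) * (a ^ h - b ^ h)\<close>; both factors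
  are even and \<open>q\<close> divides only one of them. For \<open>q = 3\<close> it is
  \<open>a - b\<close>, since 3 does not divide \<open>a + b\<close>.\<close>

lemma multiplicity_B_bound:
  assumes q: "q \<in> prime_factors m" and h: "q = 2 * h + 1"
  shows "2 * q ^ multiplicity q B \<le> a ^ h + b ^ h"
    and "q = 3 \<Longrightarrow> 2 * q ^ multiplicity q B \<le> a - b"
proof -
  note q' = exponent_prime_factor[OF q]
  define v where "v = multiplicity q B"
  have hpos: "h > 0" using h q'(1) by (cases h) auto
  have bah: "b ^ h < a ^ h" using ab(4) hpos by (intro power_strict_mono) auto
  have even: "even (a ^ h + b ^ h)" "even (a ^ h - b ^ h)" using ab bah by auto
  have "2 * q ^ v \<le> a ^ h + b ^ h \<and> (q = 3 \<longrightarrow> 2 * q ^ v \<le> a - b)"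
  proof (cases "v = 0")
    case True
    moreover have "a ^ h \<ge> 1" "b ^ h \<ge> 1" using quotient_basics by (simp_all add: Suc_le_eq)
    then have "2 \<le> a ^ h + b ^ h" by linarith
    ultimately show ?thesis using quotient_basics(4) by (simp add: le_diff_conv2)
  next
    case False
    have dvB: "q ^ v dvd B" unfolding v_def by (rule multiplicity_dvd)
    then have "q dvd B" using False by (meson dvd_power dvd_trans gr0I)
    have ban: "b ^ n \<le> a ^ n" using ab(4) by (intro power_mono) auto
    have Beq: "B * (a + b) = a ^ n - b ^ n" using B by simp
    have dv: "q ^ v dvd a ^ n - b ^ n" unfolding Beq[symmetric] using dvB by simp
    have nab: "\<not> q dvd a"
    proof
      assume "q dvd a"
      then have "q dvd a ^ n" using mn(4) by (meson dvd_power dvd_trans)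
      moreover have "q dvd B * (a + b)" using \<open>q dvd B\<close> by simp
      ultimately have "q dvd b ^ n" using B by (metis dvd_add_right_iff)
      then have "q dvd b" using q'(1) prime_dvd_power by blast
      with \<open>q dvd a\<close> show False using ab(1) q'(1) by (metis coprime_common_divisor not_prime_unit)
    qed
    have nb: "\<not> q dvd b"
    proof
      assume "q dvd b"
      then have "q dvd b ^ n" using mn(4) by (meson dvd_power dvd_trans)
      moreover have "q dvd B * (a + b)" using \<open>q dvd B\<close> by simp
      ultimately have "q dvd a ^ n" using B by (metis dvd_add)
      then show False using q'(1) prime_dvd_power nab by blast
    qed
    \<comment> \<open>By Fermat both are 1 modulo \<open>q\<close>, so the cofactor of
      \<open>X - Y\<close> in \<open>X ^ n - Y ^ n\<close> is prime to \<open>q\<close>.\<close>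
    define X Y where "X = int a ^ (q - 1)" and "Y = int b ^ (q - 1)"
    have q1: "q - 1 = 2 * h" using h by simp
    have XY: "X \<noteq> Y" unfolding X_def Y_def q1 using ab(4) hpos
      by (simp add: power_strict_mono less_imp_neq flip: of_nat_power)
        (metis ab(4) hpos less_imp_neq mult_pos_pos pos2 power_strict_mono zero_le)
    have "[X = 1] (mod int q)" "[Y = 1] (mod int q)"
      unfolding X_def Y_def using fermat_theorem[OF q'(1) nab] fermat_theorem[OF q'(1) nb]
      by (metis cong_int_iff of_nat_1 of_nat_power)+
    then have dXY: "int q dvd X - Y" by (meson cong_iff_dvd_diff cong_sym cong_trans)
    obtain Q where Q: "X ^ n - Y ^ n = (X - Y) * Q" using power_diff_sumr2 by blast
    have "[Q = int n * X ^ (n - 1)] (mod int q)"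
      using power_diff_quotient_cong[OF dXY XY Q] .
    moreover have "\<not> int q dvd int n * X ^ (n - 1)"
    proof
      assume "int q dvd int n * X ^ (n - 1)"
      then have "int q dvd int (n * (a ^ (q - 1)) ^ (n - 1))" unfolding X_def by simp
      then have "q dvd n * (a ^ (q - 1)) ^ (n - 1)" using of_nat_dvd_iff by blast
      then show False using q'(1,4) nab prime_dvd_mult_iff prime_dvd_power by metis
    qed
    ultimately have nQ: "\<not> int q dvd Q" using cong_dvd_iff by blast
    have "int (q ^ v) dvd int a ^ n - int b ^ n"
      using dv ban by (metis of_nat_diff of_nat_dvd_iff of_nat_power)
    also have "int a ^ n - int b ^ n dvd (int a ^ n) ^ (q - 1) - (int b ^ n) ^ (q - 1)"
      by (simp add: power_diff_sumr2)
    also have "\<dots> = X ^ n - Y ^ n"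
      unfolding X_def Y_def by (simp add: power_mult[symmetric] mult.commute)
    finally have "int q ^ v dvd (X - Y) * Q" using Q by simp
    moreover have "coprime (int q ^ v) Q"
      using nQ q'(1) by (intro coprime_power_left_iff[THEN iffD2] disjI1 prime_imp_coprime) auto
    ultimately have dXY': "int q ^ v dvd X - Y" by (simp add: coprime_dvd_mult_left_iff)
    have "X - Y = (int a ^ h + int b ^ h) * (int a ^ h - int b ^ h)"
      unfolding X_def Y_def q1 by (simp add: algebra_simps power_mult power2_eq_square flip: power_mult_distrib)
    also have "\<dots> = int ((a ^ h + b ^ h) * (a ^ h - b ^ h))" using bah by (simp add: of_nat_diff)
    finally have "X - Y = int ((a ^ h + b ^ h) * (a ^ h - b ^ h))" .
    then have dprod: "q ^ v dvd (a ^ h + b ^ h) * (a ^ h - b ^ h)"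
      using dXY' by (metis of_nat_dvd_iff of_nat_power)
    have not_both: "\<not> (q dvd a ^ h + b ^ h \<and> q dvd a ^ h - b ^ h)"
    proof
      assume "q dvd a ^ h + b ^ h \<and> q dvd a ^ h - b ^ h"
      then have "q dvd (a ^ h + b ^ h) + (a ^ h - b ^ h)" using dvd_add by blast
      then have "q dvd 2 * a ^ h" using bah by (simp add: mult_2)
      then have "q dvd 2 \<or> q dvd a" using q'(1) prime_dvd_mult_iff prime_dvd_power by blast
      then show False using nab q'(1,2) primes_dvd_imp_eq two_is_prime_nat by blast
    qed
    have two: "2 * q ^ v dvd k" if "q ^ v dvd k" "even k" for k
      using that q'(2) by (intro divides_mult) auto
    have "q ^ v dvd a ^ h + b ^ h \<and> q \<noteq> 3 \<or> q ^ v dvd a ^ h - b ^ h"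
    proof (cases "q dvd a ^ h + b ^ h")
      case True
      then have "coprime (q ^ v) (a ^ h - b ^ h)"
        using not_both q'(1) by (intro coprime_power_left_iff[THEN iffD2] disjI1 prime_imp_coprime) auto
      moreover have "q \<noteq> 3" using True prime_factor_not_dvd_base_sum[OF q] h by auto
      ultimately show ?thesis using dprod by (simp add: coprime_dvd_mult_left_iff)
    next
      case False
      then have "coprime (q ^ v) (a ^ h + b ^ h)"
        using q'(1) by (intro coprime_power_left_iff[THEN iffD2] disjI1 prime_imp_coprime) auto
      then show ?thesis using dprod by (simp add: coprime_dvd_mult_right_iff)
    qed
    then show ?thesis
    proof
      assume "q ^ v dvd a ^ h + b ^ h \<and> q \<noteq> 3"
      then have "2 * q ^ v dvd a ^ h + b ^ h" using two[OF _ even(1)] by blast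
      then have "2 * q ^ v \<le> a ^ h + b ^ h" using bah by (intro dvd_imp_le) linarith+
      with \<open>q ^ v dvd a ^ h + b ^ h \<and> q \<noteq> 3\<close> show ?thesis by blast
    next
      assume "q ^ v dvd a ^ h - b ^ h"
      from two[OF this even(2)] have le: "2 * q ^ v \<le> a ^ h - b ^ h"
        using bah by (intro dvd_imp_le) linarith+
      have "2 * q ^ v \<le> a - b" if "q = 3"
      proof -
        have "h = 1" using h that by simp
        then show ?thesis using le by simp
      qed
      moreover have "2 * q ^ v \<le> a ^ h + b ^ h" using le by linarith
      ultimately show ?thesis by blast
    qed
  qed
  then show "2 * q ^ multiplicity q B \<le> a ^ h + b ^ h"
    "q = 3 \<Longrightarrow> 2 * q ^ multiplicity q B \<le> a - b" by (auto simp: v_def)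
qed

lemma class_size_bound:
  assumes q: "q \<in> prime_factors m"
  shows "real (class_size q) \<le> 19/50 * ln (real a) * real q"
    and "a = 5 \<Longrightarrow> real (class_size q) \<le> 8/25 * ln (real a) * real q"
proof -
  note q' = exponent_prime_factor[OF q]
  obtain h where h: "q = 2 * h + 1" using q'(2) by (elim oddE)
  have hpos: "h > 0" using h q'(1) by (cases h) auto
  have "class_size q - 1 \<le> multiplicity q B" using class_size_multiplicity[OF q'(1)] by linarith
  then have le: "q ^ (class_size q - 1) \<le> q ^ multiplicity q B"
    using q'(1) by (intro power_increasing) (auto dest: prime_gt_0_nat)
  have "b ^ h < a ^ h" using ab(4) hpos by (intro power_strict_mono) auto
  then have "q ^ (class_size q - 1) < a ^ h"
    using le multiplicity_B_bound(1)[OF q h] by linarith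
  moreover have "2 * 3 ^ (class_size q - 1) < a" if "q = 3"
    using le multiplicity_B_bound(2)[OF q h that] quotient_basics(3,4) unfolding that by linarith
  ultimately show "real (class_size q) \<le> 19/50 * ln (real a) * real q"
    "a = 5 \<Longrightarrow> real (class_size q) \<le> 8/25 * ln (real a) * real q"
    using class_size_le[OF quotient_basics(1) h class_size_pos[OF q] q'(1)] by blast+
qed

text \<open>Use \<open>p / (p - 1) <= exp (1 / (p - 1))\<close> and distribute the primes over the
  classes; counting one several times only enlarges the bound. As \<open>A\<close> and
  \<open>q\<close> are odd, the primes of a class have \<open>p - 1 = 2 * q * j\<close> with
  distinct positive \<open>j\<close>, so their reciprocals sum to at most a harmonic number over
  \<open>2 * q\<close>.\<close>

lemma totient_ratio_A_le_exp_sum: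
  "totient_ratio A \<le> exp (\<Sum>q\<in>prime_factors m. harm (class_size q) / (2 * real q))"
proof -
  let ?P = "prime_factors A" and ?Q = "prime_factors m"
  have gt1: "p > 1" if "p \<in> ?P" for p using that by (rule prime_factor_gt_1)
  have "totient_ratio A \<le> (\<Prod>p\<in>?P. exp (1 / (real p - 1)))"
    unfolding totient_ratio_def
  proof (rule prod_mono)
    fix p assume "p \<in> ?P"
    then have "p > 1" by (rule gt1)
    then have "real p / (real p - 1) = 1 + 1 / (real p - 1)" by (simp add: field_simps)
    then show "0 \<le> real p / (real p - 1) \<and> real p / (real p - 1) \<le> exp (1 / (real p - 1))"
      using \<open>p > 1\<close> exp_ge_add_one_self[of "1 / (real p - 1)"] by simp
  qed
  also have "\<dots> = exp (\<Sum>p\<in>?P. 1 / (real p - 1))" by (simp add: exp_sum)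
  also have "(\<Sum>p\<in>?P. 1 / (real p - 1)) \<le> (\<Sum>p\<in>?P. \<Sum>q\<in>?Q. if q dvd p - 1 then 1 / (real p - 1) else 0)"
  proof (rule sum_mono)
    fix p assume p: "p \<in> ?P"
    obtain q where q: "q \<in> ?Q" "q dvd p - 1" using prime_factor_class[OF p] .
    have "1 / (real p - 1) = (\<Sum>q\<in>{q}. if q dvd p - 1 then 1 / (real p - 1) else 0)" using q by simp
    also have "\<dots> \<le> (\<Sum>q\<in>?Q. if q dvd p - 1 then 1 / (real p - 1) else 0)"
      using q gt1[OF p] by (intro sum_mono2) auto
    finally show "1 / (real p - 1) \<le> (\<Sum>q\<in>?Q. if q dvd p - 1 then 1 / (real p - 1) else 0)" .
  qed
  also have "\<dots> = (\<Sum>q\<in>?Q. \<Sum>p\<in>?P. if q dvd p - 1 then 1 / (real p - 1) else 0)"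
    by (rule sum.swap)
  also have "\<dots> \<le> (\<Sum>q\<in>?Q. harm (class_size q) / (2 * real q))"
  proof (rule sum_mono)
    fix q assume q: "q \<in> ?Q"
    note q' = exponent_prime_factor[OF q]
    have "q > 0" using q'(1) prime_gt_0_nat by blast
    define C where "C = {p \<in> ?P. q dvd p - 1}"
    define f where "f = (\<lambda>p. (p - 1) div (2 * q))"
    have f: "p - 1 = 2 * q * f p \<and> f p > 0" if "p \<in> C" for p
    proof -
      have "odd p" using that quotient_basics(7) by (auto simp: C_def in_prime_factors_iff)
      then have "2 * q dvd p - 1" using that q'(2) by (intro divides_mult) (auto simp: C_def)
      then have "p - 1 = 2 * q * f p" by (simp add: f_def)
      moreover have "p - 1 > 0" using that gt1 by (auto simp: C_def)
      ultimately show ?thesis by (metis mult_0_right gr0I less_irrefl)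
    qed
    have inj: "inj_on f C"
    proof (rule inj_onI)
      fix p r assume pr: "p \<in> C" "r \<in> C" "f p = f r"
      then have "p - 1 = r - 1" using f by metis
      moreover have "p > 1" "r > 1" using pr gt1 by (auto simp: C_def)
      ultimately show "p = r" by simp
    qed
    have "finite C" by (simp add: C_def)
    have "(\<Sum>p\<in>?P. if q dvd p - 1 then 1 / (real p - 1) else 0) = (\<Sum>p\<in>C. 1 / (real p - 1))"
      by (simp add: C_def sum.inter_filter)
    also have "\<dots> = (\<Sum>p\<in>C. 1 / real (f p) / (2 * real q))"
    proof (rule sum.cong)
      fix p assume p: "p \<in> C"
      then have "p > 1" using gt1 by (auto simp: C_def)
      then have "real p - 1 = real (p - 1)" by simp
      also have "\<dots> = 2 * real q * real (f p)" using f[OF p] by simp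
      finally show "1 / (real p - 1) = 1 / real (f p) / (2 * real q)" by simp
    qed simp
    also have "\<dots> = (\<Sum>j\<in>f ` C. 1 / real j) / (2 * real q)"
      unfolding sum_divide_distrib by (simp add: sum.reindex[OF inj])
    also have "\<dots> \<le> harm (card (f ` C)) / (2 * real q)"
      using f \<open>finite C\<close> by (intro divide_right_mono sum_inverse_le_harm) force+
    also have "card (f ` C) = class_size q"
      using inj by (simp add: card_image class_size_def C_def)
    finally show "(\<Sum>p\<in>?P. if q dvd p - 1 then 1 / (real p - 1) else 0) \<le> harm (class_size q) / (2 * real q)" .
  qed
  finally show ?thesis by simp
qed

text \<open>The real exponent \<open>19/20 * c\<close> is replaced by a rational upper bound
  \<open>i / j\<close>, to keep the later comparisons among integer powers.\<close>

lemma totient_ratio_A_power_le: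
  assumes c: "\<And>q. q \<in> prime_factors m \<Longrightarrow> real (class_size q) \<le> c * ln (real a) * real q"
    and "19/20 * c * real j \<le> real i"
  shows "totient_ratio A ^ j \<le> real a ^ i"
proof -
  have "m > 1" using mn by (cases m) (auto intro: Suc_lessI)
  then have Q: "prime_factors m \<noteq> {}" "0 \<notin> prime_factors m"
    by (auto simp: prime_factorization_empty_iff)
  have L: "ln (real a) \<ge> 0" using quotient_basics by simp
  have "(\<Sum>q\<in>prime_factors m. harm (class_size q) / (2 * real q)) \<le> 19/20 * (c * ln (real a))"
    using Q class_size_pos class_size_ge c by (intro sum_harm_le) auto
  then have "totient_ratio A \<le> exp (19/20 * (c * ln (real a)))"
    using totient_ratio_A_le_exp_sum by (meson exp_le_cancel_iff order_trans)
  moreover have "totient_ratio A \<ge> 1" unfolding totient_ratio_def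
    by (intro prod_ratio_ge_1) (rule prime_factor_gt_1)
  ultimately have "totient_ratio A ^ j \<le> exp (19/20 * (c * ln (real a))) ^ j"
    by (intro power_mono) auto
  also have "\<dots> = exp (19/20 * c * real j * ln (real a))"
    by (simp flip: exp_of_nat_mult add: mult_ac)
  also have "\<dots> \<le> exp (real i * ln (real a))"
    unfolding exp_le_cancel_iff using assms(2) L by (rule mult_right_mono)
  also have "\<dots> = real a ^ i" using quotient_basics by (simp add: exp_of_nat_mult)
  finally show ?thesis .
qed

lemma odd_coprime_impossible: False
proof -
  define x where "x = g * a"
  define h where "h = totient_ratio (z * g)"
  define R where "R = totient_ratio A"
  have R1: "R \<ge> 1" and h1: "h \<ge> 1" unfolding R_def h_def totient_ratio_def
    by (intro prod_ratio_ge_1; rule prime_factor_gt_1; assumption)+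
  have m1: "m - 1 > 0" using mn by auto
  have "real x < totient_ratio (z * (g ^ (m - 1) * A))"
    unfolding x_def using quotient_basics gz mn by (intro totient_ratio_gt_scaled[OF _ _ _ _ _ _ A B tot]) auto
  also have "z * (g ^ (m - 1) * A) = (z * g ^ (m - 1)) * A" by simp
  also have "totient_ratio \<dots> \<le> totient_ratio (z * g ^ (m - 1)) * R"
    unfolding R_def using gz quotient_basics by (intro totient_ratio_mult_le) auto
  also have "totient_ratio (z * g ^ (m - 1)) = h"
    unfolding h_def totient_ratio_def using gz m1
    by (simp add: prime_factors_product prime_factors_power)
  finally have hR: "real x < h * R" .
  have pw: "real x ^ k < h ^ k * R ^ k" if "k > 0" for k
    using power_strict_mono[OF hR _ that] by (simp add: power_mult_distrib)
  \<comment> \<open>For \<open>c = 19/50\<close> the exponent is 0.361, just below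
    \<open>4/11\<close> and \<open>3/8\<close>; for \<open>c = 8/25\<close> it is 0.304, just below
    \<open>4/13\<close>.\<close>
  have R11: "R ^ 11 \<le> real a ^ 4" and R8: "R ^ 8 \<le> real a ^ 3"
    unfolding R_def by (rule totient_ratio_A_power_le[of "19/50"]; use class_size_bound(1) in simp)+
  have R13: "R ^ 13 \<le> real a ^ 4" if "a = 5"
    unfolding R_def by (rule totient_ratio_A_power_le[of "8/25"]) (use class_size_bound(2)[OF _ that] in simp_all)
  have a3: "a \<ge> 3" using quotient_basics by simp
  have zg: "z * g > 0" using gz by simp
  have hj: "h \<le> real j" if "z * g < fact (j + 1)" for j
    unfolding h_def using totient_ratio_le_of_less_fact[OF zg that] .
  \<comment> \<open>Two distinct odd numbers differ by at least 2; this saving matters for the small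
    values of \<open>a\<close>.\<close>
  have "a + b \<le> 2 * a - 2" using quotient_basics(4) by linarith
  then have zle: "z \<le> g * (2 * a - 2)" using gz(3) by (meson mult_le_mono2 order_trans)
  show False
  proof (cases "x \<ge> 10")
    case True
    have "3 * g \<le> x" using a3 by (simp add: x_def)
    moreover have "g * (2 * a - 2) \<le> g * (2 * a)" by (intro mult_le_mono2) simp
    then have "z \<le> 2 * x" using zle unfolding x_def by linarith
    ultimately have "z * (3 * g) \<le> 2 * x * x" by (intro mult_le_mono)
    then have "real (z * (3 * g)) \<le> real (2 * x * x)" by (simp only: of_nat_le_iff)
    then have zg3: "real (z * g) \<le> 2/3 * real x ^ 2" by (simp add: power2_eq_square)
    have "h ^ 8 \<le> (15/4) ^ 8 / 30 * real (z * g)" unfolding h_def by (rule totient_ratio_power8_le[OF zg])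
    also have "\<dots> \<le> (15/4) ^ 8 / 30 * (2/3 * real x ^ 2)" using zg3 by (intro mult_left_mono) auto
    \<comment> \<open>Rounding up to \<open>10 ^ 3\<close> is what makes 10 the threshold for
      \<open>x\<close>: the estimates end in \<open>x ^ 3 < 1000\<close>.\<close>
    also have "\<dots> \<le> 1000 * real x ^ 2" by (simp add: power_divide)
    finally have "h ^ 8 \<le> 1000 * real x ^ 2" .
    moreover have "R ^ 8 \<le> real x ^ 3"
    proof -
      have "a \<le> x" using gz by (simp add: x_def)
      then have "real a ^ 3 \<le> real x ^ 3" by (intro power_mono) auto
      then show ?thesis using R8 by linarith
    qed
    ultimately have "h ^ 8 * R ^ 8 \<le> (1000 * real x ^ 2) * real x ^ 3"
      using R1 h1 by (intro mult_mono) auto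
    also have "\<dots> = 1000 * real x ^ 5" by (simp flip: power_add)
    finally have "real x ^ 8 < 1000 * real x ^ 5" using pw[of 8] by simp
    also have "real x ^ 8 = real x ^ 3 * real x ^ 5" by (simp flip: power_add)
    finally have "real x ^ 3 < 1000" by (rule mult_right_less_imp_less) simp
    moreover have "(10::real) ^ 3 \<le> real x ^ 3" using True by (intro power_mono) auto
    ultimately show False by simp
  next
    case False
    have small: False if "h \<le> c" "(c::real) ^ 11 * real a ^ 4 \<le> real x ^ 11" for c
    proof -
      have "h ^ 11 * R ^ 11 \<le> c ^ 11 * real a ^ 4"
        using that h1 R1 R11 by (intro mult_mono power_mono) auto
      then show False using pw[of 11] that by simp
    qed
    have "g \<le> 3"
    proof (rule ccontr)
      assume "\<not> g \<le> 3"
      then have "4 * 3 \<le> g * a" using a3 by (intro mult_le_mono) auto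
      then show False using False by (simp add: x_def)
    qed
    moreover have "a \<le> 9" using False gz by (cases g) (auto simp: x_def)
    ultimately consider "a = 3" "g = 1" | "a = 3" "g = 2" | "a = 3" "g = 3"
      | "a = 5" "g = 1" | "a = 7" "g = 1" | "a = 9" "g = 1"
    proof -
      have "a = 3 \<or> a = 5 \<or> a = 7 \<or> a = 9" using a3 \<open>a \<le> 9\<close> ab(2) by presburger
      moreover have "g = 1 \<or> g = 2 \<or> g = 3" using \<open>g \<le> 3\<close> gz(1) by presburger
      ultimately show ?thesis using False that unfolding x_def by fastforce
    qed
    then show False
    proof cases
      case 1
      then show False using small[of 2] hj[of 2] zle by (simp add: x_def fact_numeral eval_nat_numeral)
    next
      case 2
      then show False using small[of 3] hj[of 3] zle by (simp add: x_def fact_numeral eval_nat_numeral)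
    next
      case 3
      then show False using small[of 4] hj[of 4] zle by (simp add: x_def fact_numeral eval_nat_numeral)
    next
      case 4
      \<comment> \<open>Exponent 11 does not suffice here, since
        \<open>3 ^ 11 * 5 ^ 4 > 5 ^ 11\<close>; the sharper class bound at \<open>a = 5\<close>
        permits exponent 13.\<close>
      have "z * g < fact (3 + 1)" using 4 zle by (simp add: fact_numeral)
      then have "h \<le> 3" using hj[of 3] by simp
      then have "h ^ 13 * R ^ 13 \<le> 3 ^ 13 * real a ^ 4"
        using h1 R1 R13[OF 4(1)] by (intro mult_mono power_mono) auto
      then show False using pw[of 13] 4 by (simp add: x_def)
    next
      case 5
      then show False using small[of 3] hj[of 3] zle by (simp add: x_def fact_numeral eval_nat_numeral)
    next
      case 6
      then show False using small[of 4] hj[of 4] zle by (simp add: x_def fact_numeral eval_nat_numeral)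
    qed
  qed
qed

end

section \<open>Opposite parity and the reduction to coprime exponents\<close>

text \<open>\<open>A\<close> and \<open>B\<close> are odd, so the valuation bound at 2 leaves at
  most one odd prime factor of the argument. Two prime factors give a ratio of at most 3, hence
  \<open>g * a = 2\<close>.\<close>

lemma opposite_parity_impossible:
  fixes a b g z m n A B :: nat
  assumes ab: "odd (a + b)" "b < a" "b > 0"
    and mn: "odd m" "n > 0" "n < m"
    and A: "A * (a + b) = a ^ m + b ^ m" and B: "B * (a + b) + b ^ n = a ^ n"
    and gz: "g > 0" "z > 0" "z \<le> g * (a + b)" "z \<noteq> 2"
    and tot: "totient (z * (g ^ (m - 1) * A)) = z * (g ^ (n - 1) * B)"
  shows False
proof -
  have "m > 0" using mn by simp
  have "odd (A * (a + b))" unfolding A using ab(1) \<open>m > 0\<close> by auto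
  then have "odd A" by simp
  have "odd (B * (a + b))"
  proof -
    have "even (b ^ n) \<longleftrightarrow> odd (a ^ n)" using ab(1) mn(2) by auto
    then show ?thesis using B by (metis even_add)
  qed
  then have "odd B" by simp
  define k where "k = z * (g ^ (m - 1) * A)"
  define P where "P = {p \<in> prime_factors k. 2 dvd p - 1}"
  have "A > 0" "B > 0" using \<open>odd A\<close> \<open>odd B\<close> by (auto intro: odd_pos)
  then have cardP: "card P \<le> 1"
    using multiplicity_quotients[OF two_is_prime_nat gz(2,1) mn(3) _ _ tot] \<open>odd A\<close> \<open>odd B\<close>
    by (simp add: P_def k_def not_dvd_imp_multiplicity_0)
  have fin: "finite P" by (simp add: P_def)
  have odd_in: "p \<in> P" if "p \<in> prime_factors k" "p \<noteq> 2" for p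
  proof -
    have "prime p" using that(1) by (auto simp: in_prime_factors_iff)
    then have "odd p" using that(2) by (metis primes_dvd_imp_eq two_is_prime_nat)
    then show ?thesis using that(1) by (simp add: P_def)
  qed
  have ratio: "totient_ratio k \<le> real (card (prime_factors k)) + 1"
    using prod_ratio_le_card[of "prime_factors k"] prime_factor_gt_1[of _ k]
    by (auto simp: totient_ratio_def Suc_le_eq numeral_2_eq_2)
  have lt: "real (g * a) < totient_ratio k"
    unfolding k_def using ab gz mn by (intro totient_ratio_gt_scaled[OF _ _ _ _ _ _ A B tot]) auto
  have "card (prime_factors k) \<le> card (insert 2 P)"
    using odd_in fin by (intro card_mono) auto
  also have "\<dots> \<le> 2" using cardP fin by (simp add: card_insert_if)
  finally have "g * a < 3" using ratio lt by linarith
  moreover have "a \<ge> 2" using ab by simp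
  ultimately have "a = 2" "g = 1" "b = 1" using ab gz
    by (cases g; cases "g = 1"; cases "a = 2"; force)+
  \<comment> \<open>With \<open>z = 2\<close> excluded, the argument is odd and has at most one
    prime factor, so its ratio is at most 2.\<close>
  then have "z = 1 \<or> z = 3" using gz by auto
  then have "odd k" using \<open>g = 1\<close> \<open>odd A\<close> by (auto simp: k_def)
  then have "2 \<notin> prime_factors k" by (auto simp: in_prime_factors_iff)
  then have "prime_factors k \<subseteq> P" using odd_in by (metis subsetI)
  then have "card (prime_factors k) \<le> card P" using fin by (intro card_mono)
  then show False using ratio lt cardP \<open>a = 2\<close> \<open>g = 1\<close> by simp
qed

section \<open>Reduction to coprime bases and coprime exponents\<close>

lemma exact_quotients:
  fixes x y m n :: nat
  assumes "odd m" "even n" "y \<le> x"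
  shows "(x ^ m + y ^ m) div (x + y) * (x + y) = x ^ m + y ^ m"
    "(x ^ n - y ^ n) div (x + y) * (x + y) + y ^ n = x ^ n"
  using add_dvd_power_add_odd[OF assms(1), of x y] add_dvd_power_diff_even[OF assms(2,3)]
    power_mono[OF assms(3), of n] by simp_all

lemma scaled_quotients:
  fixes a b g m n :: nat
  assumes "odd m" "even n" "n > 0" "b < a" "g > 0"
  shows "((g * a) ^ m + (g * b) ^ m) div (g * a + g * b) = g ^ (m - 1) * ((a ^ m + b ^ m) div (a + b))"
    "((g * a) ^ n - (g * b) ^ n) div (g * a + g * b) = g ^ (n - 1) * ((a ^ n - b ^ n) div (a + b))"
proof -
  have "m > 0" using assms(1) by (rule odd_pos)
  then have pow: "g ^ m = g * g ^ (m - 1)" "g ^ n = g * g ^ (n - 1)"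
    using assms by (simp_all flip: power_Suc)
  have "(g * a) ^ m + (g * b) ^ m = g * (g ^ (m - 1) * (a ^ m + b ^ m))"
    by (simp add: power_mult_distrib pow algebra_simps)
  moreover have "(g * a) ^ n - (g * b) ^ n = g * (g ^ (n - 1) * (a ^ n - b ^ n))"
    by (simp add: power_mult_distrib pow algebra_simps diff_mult_distrib2)
  moreover have "g * a + g * b = g * (a + b)" by (simp add: algebra_simps)
  ultimately show
    "((g * a) ^ m + (g * b) ^ m) div (g * a + g * b) = g ^ (m - 1) * ((a ^ m + b ^ m) div (a + b))"
    "((g * a) ^ n - (g * b) ^ n) div (g * a + g * b) = g ^ (n - 1) * ((a ^ n - b ^ n) div (a + b))"
    using add_dvd_power_add_odd[OF assms(1), of a b] add_dvd_power_diff_even[OF assms(2), of b a] assms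
    by (simp_all only: div_mult_mult1[OF less_imp_neq[symmetric, OF assms(5)]] div_mult_swap less_imp_le)
qed

text \<open>The chain \<open>x + y\<close>, \<open>x ^ d + y ^ d\<close>,
  \<open>x ^ (d * k) \<plusminus> y ^ (d * k)\<close> is one of successive divisors, so quotients
  multiply. The first factor can then be moved into \<open>z\<close>.\<close>

lemma composed_quotients:
  fixes x y d k :: nat
  assumes "x > 0" "odd d"
  shows "odd k \<Longrightarrow> (x ^ d + y ^ d) div (x + y) * (((x ^ d) ^ k + (y ^ d) ^ k) div (x ^ d + y ^ d))
      = (x ^ (d * k) + y ^ (d * k)) div (x + y)"
    "even k \<Longrightarrow> y \<le> x \<Longrightarrow> (x ^ d + y ^ d) div (x + y) * (((x ^ d) ^ k - (y ^ d) ^ k) div (x ^ d + y ^ d))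
      = (x ^ (d * k) - y ^ (d * k)) div (x + y)"
proof -
  note d = add_dvd_power_add_odd[OF assms(2), of x y]
  have aux: "D div s * (E div D) = E div s" if "s dvd D" "D dvd E" "D > 0" for s D E :: nat
    using that by (auto elim!: dvdE)
  have "x ^ d + y ^ d > 0" using assms by simp
  note aux = aux[OF d _ this]
  show "(x ^ d + y ^ d) div (x + y) * (((x ^ d) ^ k + (y ^ d) ^ k) div (x ^ d + y ^ d))
      = (x ^ (d * k) + y ^ (d * k)) div (x + y)" if "odd k"
    unfolding power_mult by (rule aux[OF add_dvd_power_add_odd[OF that]])
  show "(x ^ d + y ^ d) div (x + y) * (((x ^ d) ^ k - (y ^ d) ^ k) div (x ^ d + y ^ d))
      = (x ^ (d * k) - y ^ (d * k)) div (x + y)" if "even k" "y \<le> x"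
    unfolding power_mult
    by (rule aux[OF add_dvd_power_diff_even[OF that(1) power_mono[OF that(2)]]]) simp
qed

theorem theorem1p4:
  shows "\<not> (\<exists>x y z m n :: nat.
    x > y \<and> y \<ge> 1 \<and> m > n \<and> n \<ge> 1 \<and> odd m \<and> even n \<and>
    1 \<le> z \<and> z \<le> x + y \<and> z \<noteq> 2 \<and>
    totient (z * ((x ^ m + y ^ m) div (x + y))) = z * ((x ^ n - y ^ n) div (x + y)))"
proof (rule notI, elim exE conjE)
  fix x y z m n :: nat
  assume xy: "y < x" "1 \<le> y" and mn: "n < m" "1 \<le> n" "odd m" "even n"
    and z: "1 \<le> z" "z \<le> x + y" "z \<noteq> 2"
    and tot: "totient (z * ((x ^ m + y ^ m) div (x + y))) = z * ((x ^ n - y ^ n) div (x + y))"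
  define g where "g = gcd x y"
  have "g > 0" using xy by (simp add: g_def)
  obtain a b where "x = a * gcd x y" "y = b * gcd x y" "coprime a b"
    using gcd_coprime_exists[of x y] xy by auto
  then have ab: "x = g * a" "y = g * b" "coprime a b" by (simp_all only: g_def mult.commute)
  have ba: "b < a" "b > 0" using xy ab \<open>g > 0\<close> by auto
  show False
  proof (cases "odd (a + b)")
    case True
    show False
    proof (rule opposite_parity_impossible[OF True ba mn(3) _ mn(1) _ _ \<open>g > 0\<close> _ _ z(3)])
      show "totient (z * (g ^ (m - 1) * ((a ^ m + b ^ m) div (a + b))))
          = z * (g ^ (n - 1) * ((a ^ n - b ^ n) div (a + b)))"
        using tot scaled_quotients[OF mn(3,4) _ ba(1) \<open>g > 0\<close>] mn(2) unfolding ab(1,2) by simp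
    qed (use mn z ba ab exact_quotients[OF mn(3,4), of b a] in \<open>auto simp: algebra_simps\<close>)
  next
    case False
    moreover have "\<not> (even a \<and> even b)" using ab(3) coprime_common_divisor[of a b 2] by auto
    ultimately have odd: "odd a" "odd b" by auto
    \<comment> \<open>As \<open>d\<close> divides the odd \<open>m\<close>, it is odd, so
      \<open>x + y\<close> divides \<open>x ^ d + y ^ d\<close> and the reduced exponents keep the
      parities of \<open>m\<close> and \<open>n\<close>.\<close>
    define d where "d = gcd m n"
    have "d > 0" using mn by (simp add: d_def)
    moreover have "odd d" using mn(3) gcd_dvd1[of m n] dvd_trans unfolding d_def by blast
    ultimately have d: "d > 0" "odd d" .
    obtain M N where "m = M * gcd m n" "n = N * gcd m n" "coprime M N"
      using gcd_coprime_exists[of m n] mn by auto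
    then have MN: "m = d * M" "n = d * N" "coprime M N" by (simp_all only: d_def mult.commute)
    have "odd M" "even N" using mn MN d by auto
    have "N > 0" "N < M" using mn MN by auto
    define D where "D = (x ^ d + y ^ d) div (x + y)"
    have D: "D * (x + y) = x ^ d + y ^ d" unfolding D_def
      by (rule dvd_div_mult_self[OF add_dvd_power_add_odd[OF d(2)]])
    have "D > 0" using D xy by (intro gr0I) auto
    have pow: "x ^ d = g ^ d * a ^ d" "y ^ d = g ^ d * b ^ d" using ab by (simp_all add: power_mult_distrib)
    have bad: "b ^ d < a ^ d" using ba d by (intro power_strict_mono) auto
    have gd: "g ^ d > 0" using \<open>g > 0\<close> by simp
    have comp: "D * (((x ^ d) ^ M + (y ^ d) ^ M) div (x ^ d + y ^ d)) = (x ^ m + y ^ m) div (x + y)"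
      "D * (((x ^ d) ^ N - (y ^ d) ^ N) div (x ^ d + y ^ d)) = (x ^ n - y ^ n) div (x + y)"
      unfolding D_def MN(1,2) using composed_quotients[of x d _ y] xy d(2) \<open>odd M\<close> \<open>even N\<close> by auto
    show False
    proof (rule odd_coprime_impossible[OF _ _ _ bad MN(3) \<open>odd M\<close> \<open>even N\<close> \<open>N > 0\<close> \<open>N < M\<close> _ _ gd])
      show "totient (z * D * ((g ^ d) ^ (M - 1) * (((a ^ d) ^ M + (b ^ d) ^ M) div (a ^ d + b ^ d))))
          = z * D * ((g ^ d) ^ (N - 1) * (((a ^ d) ^ N - (b ^ d) ^ N) div (a ^ d + b ^ d)))"
        using tot comp scaled_quotients[OF \<open>odd M\<close> \<open>even N\<close> \<open>N > 0\<close> bad gd]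
        unfolding pow by (metis mult.assoc)
      show "z * D \<le> g ^ d * (a ^ d + b ^ d)"
      proof -
        have "z * D \<le> (x + y) * D" using z(2) by (intro mult_le_mono1)
        also have "\<dots> = g ^ d * (a ^ d + b ^ d)" using D pow by (simp add: algebra_simps)
        finally show ?thesis .
      qed
    qed (use ab odd z \<open>D > 0\<close> bad exact_quotients[OF \<open>odd M\<close> \<open>even N\<close>, of "b ^ d" "a ^ d"] in auto)
  qed
qed

end
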